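(* Let $G$ be a connected graph and let $A$ be its incidence matrix. Then the system $x\geq 0;\ xA\leq\mathbf{1}$ has the integer rounding property if and only if, for any two vertex disjoint odd cycles of $G$, the subgraph of $G$ induced on the union of the vertex sets of the two cycles is connected.
   Context: Graphs are finite and simple, and have no isolated vertices (each vertex occurs in at least one edge). If $G$ has vertex set $X=\{x_1,\ldots,x_n\}$ and edges $f_1,\ldots,f_q$, the characteristic vector of $f_k$ is $v_k=\sum_{x_i\in f_k}e_i\in\mathbb{R}^n$, where $e_i$ is the $i$-th unit vector, and the incidence matrix $A$ of $G$ is the $n\times q$ matrix with column vectors $v_1,\ldots,v_q$. Inequalities between vectors are entrywise, $\mathbf{1}$ is the vector with all entries equal to $1$, $\langle\ ,\ \rangle$ is the standard inner product, and $\mathbb{N}=\{0,1,2,\ldots\}$. The system $x\geq 0;\ xA\leq\mathbf{1}$ has the integer rounding property if $$\lceil\min\{\langle y,\mathbf{1}\rangle \mid y\geq 0;\ Ay\geq \alpha\}\rceil=\min\{\langle y,\mathbf{1}\rangle \mid Ay\geq \alpha;\ y\in\mathbb{N}^q\}$$ for each integral vector $\alpha\in\mathbb{Z}^n$ for which $\min\{\langle y,\mathbf{1}\rangle \mid y\geq 0;\ Ay\geq \alpha\}$ is finite (here $y$ ranges over $\mathbb{R}^q$ in the left-hand minimum). *)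

theory Defs
  imports Complex_Main "Jordan_Normal_Form.Matrix" "Graph_Theory.Graph_Theory"
begin

text \<open>
  A finite simple graph is a \<^locale>\<open>pair_graph\<close> of the entry Graph_Theory: a finite, symmetric,
  loop-free digraph without parallel arcs. An edge is the pair of opposite arcs between its two
  end vertices, recorded here as the set of these vertices.
\<close>

definition edges :: "'a pair_pre_digraph \<Rightarrow> 'a set set" where
  "edges G = {{u, v} | u v. (u, v) \<in> parcs G}"

definition no_isolated_vertices :: "'a pair_pre_digraph \<Rightarrow> bool" where
  "no_isolated_vertices G \<longleftrightarrow> (\<forall>x \<in> pverts G. \<exists>f \<in> edges G. x \<in> f)"

text \<open>
  \<^const>\<open>pre_digraph.cycle\<close> also admits closed walks u, v, u along a single edge. They have
  length 2; in a loop-free graph the cycles of odd length have length at least 3 and are the odd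
  cycles in the usual sense. A cycle is given by its list of arcs.
\<close>

definition odd_cycle :: "'a pair_pre_digraph \<Rightarrow> ('a \<times> 'a) list \<Rightarrow> bool" where
  "odd_cycle G p \<longleftrightarrow> pre_digraph.cycle (with_proj G) p \<and> odd (length p)"

definition cycle_verts :: "('a \<times> 'a) list \<Rightarrow> 'a set" where
  "cycle_verts p = fst ` set p \<union> snd ` set p"

text \<open>
  The lists \<open>xs\<close> and \<open>fs\<close> enumerate the vertices and the edges.
\<close>

definition char_vector :: "'a list \<Rightarrow> 'a set \<Rightarrow> real vec" where
  "char_vector xs f = vec (length xs) (\<lambda>i. if xs ! i \<in> f then 1 else 0)"

definition incidence_matrix :: "'a list \<Rightarrow> 'a set list \<Rightarrow> real mat" where
  "incidence_matrix xs fs = mat_of_cols (length xs) (map (char_vector xs) fs)"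

definition ones_vec :: "nat \<Rightarrow> real vec" where
  "ones_vec n = vec n (\<lambda>_. 1)"

definition is_min :: "real set \<Rightarrow> real \<Rightarrow> bool" where
  "is_min S m \<longleftrightarrow> m \<in> S \<and> (\<forall>s \<in> S. m \<le> s)"

definition real_values :: "real mat \<Rightarrow> int vec \<Rightarrow> real set" where
  "real_values A \<alpha> = {y \<bullet> ones_vec (dim_col A) | y.
     y \<in> carrier_vec (dim_col A) \<and> 0\<^sub>v (dim_col A) \<le> y \<and> map_vec real_of_int \<alpha> \<le> A *\<^sub>v y}"

definition integer_values :: "real mat \<Rightarrow> int vec \<Rightarrow> real set" where
  "integer_values A \<alpha> = {map_vec real y \<bullet> ones_vec (dim_col A) | y :: nat vec.
     y \<in> carrier_vec (dim_col A) \<and> map_vec real_of_int \<alpha> \<le> A *\<^sub>v map_vec real y}"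

text \<open>
  The integer rounding property of the system \<open>x \<ge> 0; xA \<le> 1\<close>. The real minimum is finite iff
  some real number \<open>m\<close> is the minimum (a feasible linear program whose values are bounded below
  attains its infimum).
\<close>

definition integer_rounding_property :: "real mat \<Rightarrow> bool" where
  "integer_rounding_property A \<longleftrightarrow>
     (\<forall>\<alpha> \<in> carrier_vec (dim_row A). \<forall>m.
        is_min (real_values A \<alpha>) m \<longrightarrow> is_min (integer_values A \<alpha>) (of_int \<lceil>m\<rceil>))"

end

theory Submission
  imports Defs
begin

text \<open>
  A vector \<open>y\<close> with \<open>Ay \<ge> \<alpha>\<close> is a weighting of the edges in which the load of every vertex \<open>x\<close>, the sum
  of the weights at \<open>x\<close>, is at least \<open>\<alpha>\<^sub>x\<close>. If two disjoint odd cycles are joined by no edge,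
  let \<open>\<alpha>\<close> be the indicator of their vertices. Weight \<open>1 / 2\<close> on the cycles is optimal and its value
  is half the number of these vertices, so an integral solution of that value would match the
  vertices of each odd cycle perfectly among themselves.

  Conversely, among the optimal solutions choose one with the fewest fractional edges and vertices
  that are not tight. No perturbation on the fractional edges preserves the loads of the tight
  vertices, hence the fractional edges form disjoint odd cycles of tight vertices with weights in
  \<open>\<int> + 1 / 2\<close>. Two such cycles joined by an edge can be made integral at no cost by alternating along
  both, so there is at most one; alternating along it costs \<open>1 / 2\<close>, which is the rounding gap.
\<close>

section \<open>Walks and edge weights\<close>

fun walk_edges :: "'a list \<Rightarrow> 'a set list" where
  "walk_edges (u # v # ws) = {u, v} # walk_edges (v # ws)"
| "walk_edges _ = []"

text \<open>Repeated edges add up their signed contributions, so loads and totals follow by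
  recursion along the walk, without assuming its edges distinct.\<close>

fun alternating :: "real \<Rightarrow> 'a list \<Rightarrow> 'a set \<Rightarrow> real" where
  "alternating s (u # v # ws) e = (if e = {u, v} then s else 0) + alternating (- s) (v # ws) e"
| "alternating s _ e = 0"

lemma walk_edges_append_Cons:
  "walk_edges (xs @ y # ys) = walk_edges (xs @ [y]) @ walk_edges (y # ys)"
proof (induction xs)
  case (Cons x xs)
  then show ?case by (cases xs) auto
qed simp

lemma walk_edges_subset: "e \<in> set (walk_edges w) \<Longrightarrow> e \<subseteq> set w"
  by (induction w rule: walk_edges.induct) auto

lemma length_walk_edges: "length (walk_edges w) = length w - 1"
  by (induction w rule: walk_edges.induct) auto

lemma distinct_walk_edges: "distinct w \<Longrightarrow> distinct (walk_edges w)"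
  by (induction w rule: walk_edges.induct) (auto dest!: walk_edges_subset)

text \<open>Past the first edge the walk has distinct vertices. The first edge \<open>{a, b}\<close>
  does not recur: \<open>b\<close> lies on no edge after the second, and the second ends in
  \<open>r\<close>, which differs from \<open>a\<close>. With only two vertices both edges would
  coincide.\<close>

lemma distinct_walk_edges_cycle:
  assumes "distinct c" "3 \<le> length c"
  shows "distinct (walk_edges (c @ [hd c]))"
proof -
  obtain a b r rs where c: "c = a # b # r # rs"
    using assms(2) by (metis (no_types) One_nat_def Suc_le_length_iff numeral_3_eq_3)
  have "distinct (b # r # rs @ [a])" using assms c by auto
  then have "distinct (walk_edges (b # r # rs @ [a]))" by (rule distinct_walk_edges)
  moreover have "{a, b} \<notin> set (walk_edges (r # rs @ [a]))"
    using walk_edges_subset[of "{a, b}" "r # rs @ [a]"] assms c by auto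
  ultimately show ?thesis using assms c by (auto simp: doubleton_eq_iff)
qed

lemma count_list_distinct: "distinct xs \<Longrightarrow> count_list xs x = of_bool (x \<in> set xs)"
  by (induction xs) auto

lemma alternating_notin: "e \<notin> set (walk_edges w) \<Longrightarrow> alternating s w e = 0"
  by (induction s w e rule: alternating.induct) auto

lemma alternating_in:
  "distinct (walk_edges w) \<Longrightarrow> e \<in> set (walk_edges w) \<Longrightarrow> alternating s w e = s \<or> alternating s w e = - s"
  by (induction s w e rule: alternating.induct) (auto simp: alternating_notin)

definition load :: "'a set set \<Rightarrow> ('a set \<Rightarrow> real) \<Rightarrow> 'a \<Rightarrow> real" where
  "load E y x = (\<Sum>e | e \<in> E \<and> x \<in> e. y e)"

lemma load_add: "load E (\<lambda>e. y e + z e) x = load E y x + load E z x"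
  by (simp add: load_def sum.distrib)

lemma load_scale: "load E (\<lambda>e. t * y e) x = t * load E y x"
  by (simp add: load_def sum_distrib_left)

text \<open>The list names each vertex once and appending \<open>hd c\<close> supplies the closing
  edge. The bound 3 excludes walking back and forth along a single edge.\<close>

definition cycle_in :: "'a set set \<Rightarrow> 'a list \<Rightarrow> bool" where
  "cycle_in F c \<longleftrightarrow> distinct c \<and> 3 \<le> length c \<and> set (walk_edges (c @ [hd c])) \<subseteq> F"

lemma cycle_in_mono: "cycle_in F c \<Longrightarrow> F \<subseteq> E \<Longrightarrow> cycle_in E c"
  by (auto simp: cycle_in_def)

lemma cycle_in_rotate1:
  assumes "cycle_in F c"
  shows "cycle_in F (rotate1 c)
    \<and> set (walk_edges (rotate1 c @ [hd (rotate1 c)])) = set (walk_edges (c @ [hd c]))"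
proof -
  obtain a b cs where c: "c = a # b # cs" 
    using assms unfolding cycle_in_def by (metis (no_types) Suc_le_length_iff numeral_3_eq_3)
  have "set (walk_edges (b # cs @ [a, b])) = set (walk_edges (a # b # cs @ [a]))"
    using walk_edges_append_Cons[of "b # cs" a "[b]"] by auto
  then show ?thesis using assms c by (auto simp: cycle_in_def)
qed

text \<open>Alternating around an odd cycle changes the load only at the head of the list; rotation
  allows any vertex of the cycle to take that place.\<close>

lemma cycle_in_rooted:
  assumes "cycle_in F c" "u \<in> set c"
  obtains c' where "cycle_in F c'" "hd c' = u" "set c' = set c" "length c' = length c"
    "set (walk_edges (c' @ [hd c'])) = set (walk_edges (c @ [hd c]))"
proof -
  have rot: "cycle_in F (rotate n c)
    \<and> set (walk_edges (rotate n c @ [hd (rotate n c)])) = set (walk_edges (c @ [hd c]))" for n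
    using assms(1) by (induction n) (use cycle_in_rotate1 in \<open>auto simp del: rotate1.simps\<close>)
  obtain n where n: "n < length c" "c ! n = u" using assms(2) by (auto simp: in_set_conv_nth)
  then have "hd (rotate n c) = u" by (metis hd_rotate_conv_nth length_0_conv mod_less not_less_zero)
  then show thesis using that[of "rotate n c"] rot[of n] by simp
qed

text \<open>The head of a longest path has a second edge in \<open>F\<close>. This edge cannot
  extend the path, so it leads back to the path and closes a cycle.\<close>

lemma exists_cycle_in:
  assumes fin: "finite F" and two: "\<And>e. e \<in> F \<Longrightarrow> card e = 2" and ne: "F \<noteq> {}"
    and deg: "\<And>x e. e \<in> F \<Longrightarrow> x \<in> e \<Longrightarrow> \<exists>e'\<in>F. e' \<noteq> e \<and> x \<in> e'"
  obtains c where "cycle_in F c"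
proof -
  define P where "P w \<longleftrightarrow> distinct w \<and> set (walk_edges w) \<subseteq> F \<and> 2 \<le> length w" for w :: "'a list"
  have finU: "finite (\<Union>F)" using fin two by (metis card_eq_0_iff finite_Union zero_neq_numeral)
  obtain e where "e \<in> F" using ne by auto
  then obtain u v where "e = {u, v}" "u \<noteq> v" using two card_2_iff by metis
  then have "P [u, v]" using \<open>e \<in> F\<close> by (simp add: P_def)
  \<comment> \<open>A path with at least one edge stays inside the finite set of ends of edges of
    \<open>F\<close>, so a longest path exists.\<close>
  moreover have "length w < Suc (card (\<Union>F))" if "P w" for w
  proof -
    have verts: "set w \<subseteq> \<Union>(set (walk_edges w))" if "2 \<le> length w" for w :: "'a list"
      using that
    proof (induction w rule: walk_edges.induct)
      case (1 u v ws)
      then show ?case by (cases ws) auto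
    qed auto
    have "set w \<subseteq> \<Union>F" using that verts[of w] unfolding P_def by blast
    then have "card (set w) \<le> card (\<Union>F)" using finU card_mono by blast
    then show ?thesis using that by (simp add: P_def distinct_card)
  qed
  ultimately obtain w where w: "P w" and max: "\<And>w'. P w' \<Longrightarrow> length w' \<le> length w"
    using ex_has_greatest_nat[of P "[u, v]" length] by metis
  obtain a b ws where ws: "w = a # b # ws"
    using w unfolding P_def by (metis (no_types) Suc_le_length_iff numeral_2_eq_2)
  have "{a, b} \<in> F" using w ws by (auto simp: P_def)
  then obtain e' where e': "e' \<in> F" "e' \<noteq> {a, b}" "a \<in> e'" using deg[of "{a, b}" a] by auto
  then obtain d where d: "e' = {d, a}" "d \<noteq> a"
    using two by (metis card_2_iff insertE insert_commute singletonD)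
  have "d \<in> set w"
  proof (rule ccontr)
    assume "d \<notin> set w"
    then have "P (d # w)" using w ws d e' by (auto simp: P_def)
    then show False using max by fastforce
  qed
  \<comment> \<open>\<open>d\<close> differs from \<open>a\<close>, and also from \<open>b\<close>
    since \<open>e'\<close> is not \<open>{a, b}\<close>; hence the cycle has at least three
    vertices.\<close>
  then have "d \<in> set ws" using ws d e' by auto
  then obtain us vs where uv: "ws = us @ d # vs" by (meson split_list)
  define c where "c = a # b # us @ [d]"
  have "set (walk_edges c) \<subseteq> F"
    using w ws uv walk_edges_append_Cons[of "a # b # us" d vs] by (auto simp: P_def c_def)
  moreover have "walk_edges (c @ [hd c]) = walk_edges c @ [{d, a}]"
    using walk_edges_append_Cons[of "a # b # us" d "[a]"] by (simp add: c_def)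
  ultimately have "cycle_in F c"
    using w ws uv d e' by (auto simp: P_def cycle_in_def c_def)
  then show thesis by (rule that)
qed

section \<open>Loads and total weights along walks and cycles\<close>

locale edge_set =
  fixes E :: "'a set set"
  assumes finite_E: "finite E" and card_edge: "e \<in> E \<Longrightarrow> card e = 2"
begin

lemma finite_at: "finite {e \<in> E. x \<in> e}"
  using finite_E by simp

lemma load_single:
  assumes "{u, v} \<in> E"
  shows "load E (\<lambda>e. if e = {u, v} then s else 0) x = s * (of_bool (x = u) + of_bool (x = v))"
proof -
  have "u \<noteq> v" using card_edge[OF assms] by auto
  have "load E (\<lambda>e. if e = {u, v} then s else 0) x = (if x \<in> {u, v} then s else 0)"
    unfolding load_def using assms by (subst sum.delta) (auto simp: finite_at)
  then show ?thesis using \<open>u \<noteq> v\<close> by auto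
qed

text \<open>Consecutive edges contribute \<open>s\<close> and \<open>- s\<close> at the vertex they
  share, so only the two ends of the walk survive; the sign at the last one is decided by
  parity.\<close>

lemma load_alternating:
  assumes "set (walk_edges w) \<subseteq> E" "w \<noteq> []"
  shows "load E (alternating s w) x = s * (of_bool (x = hd w) + (- 1) ^ length w * of_bool (x = last w))"
  using assms
proof (induction w arbitrary: s rule: walk_edges.induct)
  case (1 u v ws)
  have "load E (alternating s (u # v # ws)) x
    = load E (\<lambda>e. if e = {u, v} then s else 0) x + load E (alternating (- s) (v # ws)) x"
    by (simp add: load_def sum.distrib)
  also have "\<dots> = s * (of_bool (x = u) + of_bool (x = v))
      - s * (of_bool (x = v) + (- 1) ^ length (v # ws) * of_bool (x = last (v # ws)))"
    using 1 by (subst load_single) auto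
  also have "\<dots> = s * (of_bool (x = hd (u # v # ws))
      + (- 1) ^ length (u # v # ws) * of_bool (x = last (u # v # ws)))"
    by (simp add: algebra_simps)
  finally show ?case .
qed (auto simp: load_def)

text \<open>\<open>length w\<close> counts vertices: an even length means an odd number of edges,
  one of which is left uncancelled.\<close>

lemma sum_alternating:
  assumes "set (walk_edges w) \<subseteq> E" "w \<noteq> []"
  shows "(\<Sum>e\<in>E. alternating s w e) = s * of_bool (even (length w))"
  using assms
proof (induction w arbitrary: s rule: walk_edges.induct)
  case (1 u v ws)
  have "(\<Sum>e\<in>E. alternating s (u # v # ws) e)
    = (\<Sum>e\<in>E. if e = {u, v} then s else 0) + (\<Sum>e\<in>E. alternating (- s) (v # ws) e)"
    by (simp add: sum.distrib)
  also have "\<dots> = s - s * of_bool (even (length (v # ws)))"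
    using 1 finite_E by simp
  finally show ?case by simp
qed auto

text \<open>Each visit of the walk to a vertex uses two edges, one in and one out, except that each
  end of the walk lacks one of them.\<close>

lemma load_count:
  assumes "set (walk_edges w) \<subseteq> E" "w \<noteq> []"
  shows "load E (\<lambda>e. real (count_list (walk_edges w) e)) x
    = 2 * real (count_list w x) - of_bool (x = hd w) - of_bool (x = last w)"
  using assms
proof (induction w rule: walk_edges.induct)
  case (1 u v ws)
  have "load E (\<lambda>e. real (count_list (walk_edges (u # v # ws)) e)) x
    = load E (\<lambda>e. (if e = {u, v} then 1 else 0) + real (count_list (walk_edges (v # ws)) e)) x"
    by (intro arg_cong2[where f = "load E"] ext refl) auto
  also have "\<dots> = of_bool (x = u) + of_bool (x = v)
      + load E (\<lambda>e. real (count_list (walk_edges (v # ws)) e)) x"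
    using 1 by (subst load_add, subst load_single) auto
  finally show ?case using 1 by auto
qed (auto simp: load_def)

lemma sum_count:
  assumes "set (walk_edges w) \<subseteq> E"
  shows "(\<Sum>e\<in>E. real (count_list (walk_edges w) e)) = real (length w - 1)"
proof -
  have "(\<Sum>e\<in>E. count_list (walk_edges w) e) = length (walk_edges w)"
    using assms finite_E by (metis sum_count_set)
  then show ?thesis by (metis length_walk_edges of_nat_sum)
qed

lemma load_count_cycle:
  assumes "cycle_in E c"
  shows "load E (\<lambda>e. real (count_list (walk_edges (c @ [hd c])) e)) x = 2 * of_bool (x \<in> set c)"
proof -
  have "c \<noteq> []" "distinct c" using assms by (auto simp: cycle_in_def)
  then have "count_list c x = of_bool (x \<in> set c)"
    by (simp add: count_list_distinct) 
  then show ?thesis using assms \<open>c \<noteq> []\<close> by (subst load_count) (auto simp: cycle_in_def hd_append)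
qed

text \<open>The edges of a cycle are distinct, so their multiplicities are 0 or 1 and the load of
  the multiplicities counts edges.\<close>

lemma card_cycle_edges_at:
  assumes "cycle_in E c" "x \<in> set c"
  shows "card {e \<in> set (walk_edges (c @ [hd c])). x \<in> e} = 2"
proof -
  let ?W = "walk_edges (c @ [hd c])"
  have sub: "set ?W \<subseteq> E" and "distinct ?W"
    using assms distinct_walk_edges_cycle by (auto simp: cycle_in_def)
  then have cnt: "real (count_list ?W e) = of_bool (e \<in> set ?W)" for e
    by (simp add: count_list_distinct)
  have "2 = load E (\<lambda>e. of_bool (e \<in> set ?W)) x"
    using load_count_cycle[OF assms(1), of x] assms(2) by (simp only: cnt) simp
  also have "\<dots> = (\<Sum>e | e \<in> E \<and> x \<in> e. of_bool (e \<in> set ?W))" by (simp add: load_def)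
  also have "\<dots> = real (card {e \<in> set ?W. x \<in> e})"
  proof -
    have "{e \<in> E. x \<in> e} \<inter> {e. e \<in> set ?W} = {e \<in> set ?W. x \<in> e}" using sub by auto
    then show ?thesis using finite_at[of x] by (simp add: sum_of_bool_eq)
  qed
  finally show ?thesis by linarith
qed

text \<open>Both ends of the closed walk are the root \<open>hd c\<close>. Their contributions add
  up for odd length and cancel for even length.\<close>

lemma load_alternating_cycle:
  assumes "cycle_in E c"
  shows "load E (alternating s (c @ [hd c])) x = s * 2 * of_bool (odd (length c) \<and> x = hd c)"
  using assms by (subst load_alternating) (auto simp: cycle_in_def hd_append)

text \<open>Double counting of the incidences between \<open>W\<close> and the edges. It serves both
  the duality bound and the parity argument for two cycles joined by no edge.\<close>

lemma sum_load:
  assumes "finite W"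
  shows "(\<Sum>x\<in>W. load E y x) = (\<Sum>e\<in>E. y e * real (card (e \<inter> W)))"
proof -
  have "(\<Sum>x\<in>W. load E y x) = (\<Sum>x\<in>W. \<Sum>e\<in>E. if x \<in> e then y e else 0)"
    unfolding load_def using finite_E by (simp add: sum.inter_filter)
  also have "\<dots> = (\<Sum>e\<in>E. \<Sum>x\<in>W. if x \<in> e then y e else 0)" by (rule sum.swap)
  also have "\<dots> = (\<Sum>e\<in>E. y e * real (card (e \<inter> W)))"
  proof (rule sum.cong[OF refl])
    fix e
    have "(\<Sum>x\<in>W. if x \<in> e then y e else 0) = (\<Sum>x\<in>{x \<in> W. x \<in> e}. y e)"
      using assms by (simp only: sum.inter_filter)
    moreover have "{x \<in> W. x \<in> e} = e \<inter> W" by auto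
    ultimately show "(\<Sum>x\<in>W. if x \<in> e then y e else 0) = y e * real (card (e \<inter> W))"
      by simp
  qed
  finally show ?thesis .
qed

end

section \<open>Fractional covers\<close>

text \<open>Gaussian elimination: by induction on the equations, a nonzero coefficient of the new
  equation is used to eliminate one unknown from the others.\<close>

lemma homogeneous_system_solution:
  fixes M :: "'i \<Rightarrow> 'j \<Rightarrow> 'k :: field"
  assumes "finite T" "finite H" "card T < card H"
  obtains z where "\<exists>e\<in>H. z e \<noteq> 0" "\<And>x. x \<in> T \<Longrightarrow> (\<Sum>e\<in>H. M x e * z e) = 0"
proof -
  have "\<exists>z. (\<exists>e\<in>H. z e \<noteq> 0) \<and> (\<forall>x\<in>T. (\<Sum>e\<in>H. M x e * z e) = 0)"
    using assms
  proof (induction T arbitrary: H M rule: finite_induct)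
    case empty
    then show ?case by (intro exI[of _ "\<lambda>_. 1"]) (auto simp: card_gt_0_iff)
  next
    case (insert x T)
    show ?case
    proof (cases "\<forall>e\<in>H. M x e = 0")
      case True
      then show ?thesis using insert.IH[of H M] insert by auto
    next
      case False
      then obtain p where p: "p \<in> H" "M x p \<noteq> 0" by auto
      \<comment> \<open>Subtracting a multiple of equation \<open>x\<close> makes the coefficient of
        the unknown \<open>p\<close> vanish in every other equation.\<close>
      define N where "N i e = M i e - M i p * M x e / M x p" for i e
      have "card T < card (H - {p})" using insert p by simp
      then obtain z where z: "\<exists>e\<in>H - {p}. z e \<noteq> 0"
        "\<And>i. i \<in> T \<Longrightarrow> (\<Sum>e\<in>H - {p}. N i e * z e) = 0"
        using insert.IH[of "H - {p}" N] insert.prems by auto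
      \<comment> \<open>Equation \<open>x\<close> solved for the unknown \<open>p\<close>.\<close>
      define r where "r = - (\<Sum>e\<in>H - {p}. M x e * z e) / M x p"
      define z' where "z' = z(p := r)"
      have split: "(\<Sum>e\<in>H. M i e * z' e) = M i p * r + (\<Sum>e\<in>H - {p}. M i e * z e)" for i
        using p insert.prems by (simp add: sum.remove[of H p] z'_def)
      have "(\<Sum>e\<in>H. M i e * z' e) = 0" if "i \<in> T" for i
      proof -
        have "(\<Sum>e\<in>H - {p}. M i e * z e)
          = (\<Sum>e\<in>H - {p}. N i e * z e) + M i p / M x p * (\<Sum>e\<in>H - {p}. M x e * z e)"
          by (simp add: N_def algebra_simps sum_subtractf sum_distrib_left)
        then show ?thesis using z(2)[OF that] p split by (simp add: r_def)
      qed
      moreover have "(\<Sum>e\<in>H. M x e * z' e) = 0" using p split by (simp add: r_def)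
      moreover have "\<exists>e\<in>H. z' e \<noteq> 0" using z(1) by (auto simp: z'_def)
      ultimately show ?thesis by auto
    qed
  qed
  then show thesis using that by blast
qed

text \<open>A nonnegative number with fractional part \<open>1 / 2\<close> is at least
  \<open>1 / 2\<close>, so a shift by one half in either direction ends at a nonnegative
  integer.\<close>

lemma frac_half:
  fixes r :: real
  assumes "frac r = 1 / 2" "0 \<le> r" "s = 1 / 2 \<or> s = - 1 / 2"
  shows "0 \<le> r + s" "r + s \<in> \<int>"
proof -
  have r: "r = of_int \<lfloor>r\<rfloor> + 1 / 2" using assms(1) by (simp add: frac_def)
  have "0 \<le> \<lfloor>r\<rfloor>" using assms(2) by simp
  then have "0 \<le> (of_int \<lfloor>r\<rfloor> :: real)" by simp
  then show "0 \<le> r + s" using r assms(3) by linarith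
  have "r + s = of_int \<lfloor>r\<rfloor> \<or> r + s = of_int (\<lfloor>r\<rfloor> + 1)" using r assms(3) by fastforce
  then show "r + s \<in> \<int>" by (metis Ints_of_int)
qed

definition covers :: "'a set set \<Rightarrow> 'a set \<Rightarrow> ('a \<Rightarrow> int) \<Rightarrow> ('a set \<Rightarrow> real) \<Rightarrow> bool" where
  "covers E V a y \<longleftrightarrow> (\<forall>e\<in>E. 0 \<le> y e) \<and> (\<forall>x\<in>V. of_int (a x) \<le> load E y x)"

definition cover_values :: "'a set set \<Rightarrow> 'a set \<Rightarrow> ('a \<Rightarrow> int) \<Rightarrow> real set" where
  "cover_values E V a = {sum y E | y. covers E V a y}"

definition int_cover_values :: "'a set set \<Rightarrow> 'a set \<Rightarrow> ('a \<Rightarrow> int) \<Rightarrow> real set" where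
  "int_cover_values E V a = {sum y E | y. covers E V a y \<and> (\<forall>e\<in>E. y e \<in> \<int>)}"

section \<open>Optimal covers of least defect\<close>

locale cover_problem = edge_set E for E :: "'a set set" +
  fixes V :: "'a set" and a :: "'a \<Rightarrow> int"
  assumes finite_V: "finite V" and edges_sub: "\<Union>E \<subseteq> V"
begin

definition nonint :: "('a set \<Rightarrow> real) \<Rightarrow> 'a set set" where
  "nonint y = {e \<in> E. y e \<notin> \<int>}"

definition slack :: "('a set \<Rightarrow> real) \<Rightarrow> 'a set" where
  "slack y = {x \<in> V. of_int (a x) < load E y x}"

definition defect :: "('a set \<Rightarrow> real) \<Rightarrow> nat" where
  "defect y = card (nonint y) + card (slack y)"

definition extremal :: "('a set \<Rightarrow> real) \<Rightarrow> bool" where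
  "extremal y \<longleftrightarrow> covers E V a y \<and> (\<forall>y'. covers E V a y' \<longrightarrow> sum y E \<le> sum y' E)
    \<and> (\<forall>y'. covers E V a y' \<and> sum y' E = sum y E \<longrightarrow> defect y \<le> defect y')"

lemma finite_nonint: "finite (nonint y)" and finite_slack: "finite (slack y)"
  using finite_E finite_V by (auto simp: nonint_def slack_def)

lemma exists_extremal:
  assumes "is_min (cover_values E V a) m"
  obtains y where "extremal y" "sum y E = m"
proof -
  define P where "P y \<longleftrightarrow> covers E V a y \<and> sum y E = m" for y
  obtain y0 where "P y0" using assms by (auto simp: is_min_def cover_values_def P_def)
  then obtain y where "P y" and "\<And>y'. P y' \<Longrightarrow> defect y \<le> defect y'"
    using ex_has_least_nat[of P y0 defect] by metis
  moreover have "m \<le> sum y' E" if "covers E V a y'" for y'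
    using assms that by (auto simp: is_min_def cover_values_def)
  ultimately show thesis using that[of y] by (auto simp: P_def extremal_def)
qed

text \<open>Move along \<open>z\<close> until a fractional edge first becomes integral or a slack
  vertex first becomes tight. Integral edges keep their weights and tight vertices their loads, so
  neither a fractional edge nor a slack vertex is created.\<close>

lemma push:
  assumes cov: "covers E V a y"
    and supp: "\<And>e. e \<in> E \<Longrightarrow> y e \<in> \<int> \<Longrightarrow> z e = 0"
    and tight: "\<And>x. x \<in> V - slack y \<Longrightarrow> load E z x = 0"
    and ne: "\<exists>e\<in>E. z e \<noteq> 0"
  obtains t where "0 < t" "covers E V a (\<lambda>e. y e + t * z e)" "defect (\<lambda>e. y e + t * z e) < defect y"
proof -
  \<comment> \<open>\<open>\<tau> e\<close> is the time at which edge \<open>e\<close> reaches the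
    next integer in its direction of motion, and \<open>\<sigma> x\<close> the time at which a slack
    vertex of falling load becomes tight. The step length \<open>t\<close> is the earliest of these
    times.\<close>
  define \<tau> where "\<tau> e = (if z e > 0 then of_int \<lceil>y e\<rceil> - y e else y e - of_int \<lfloor>y e\<rfloor>) / \<bar>z e\<bar>" for e
  define \<sigma> where "\<sigma> x = (load E y x - of_int (a x)) / (- load E z x)" for x
  define D where "D = {e \<in> E. z e \<noteq> 0}"
  define S where "S = {x \<in> slack y. load E z x < 0}"
  define t where "t = Min (\<tau> ` D \<union> \<sigma> ` S)"
  define y' where "y' e = y e + t * z e" for e
  have fin: "finite (\<tau> ` D \<union> \<sigma> ` S)" using finite_E finite_slack by (simp add: D_def S_def)
  have nemp: "\<tau> ` D \<union> \<sigma> ` S \<noteq> {}" using ne by (auto simp: D_def)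
  have nonint: "y e \<notin> \<int>" if "e \<in> D" for e using that supp by (auto simp: D_def)
  have \<tau>_pos: "0 < \<tau> e" if "e \<in> D" for e
  proof -
    have "y e \<noteq> of_int \<lceil>y e\<rceil>" "y e \<noteq> of_int \<lfloor>y e\<rfloor>" using nonint[OF that] by (metis Ints_of_int)+
    then have "y e < of_int \<lceil>y e\<rceil>" "of_int \<lfloor>y e\<rfloor> < y e" by linarith+
    then show ?thesis using that by (auto simp: \<tau>_def D_def)
  qed
  have \<sigma>_pos: "0 < \<sigma> x" if "x \<in> S" for x
    using that unfolding \<sigma>_def S_def slack_def by (intro divide_pos_pos) auto
  have t_pos: "0 < t" using fin nemp \<tau>_pos \<sigma>_pos by (auto simp: t_def)
  have t\<tau>: "t \<le> \<tau> e" if "e \<in> D" for e using fin that by (auto simp: t_def)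
  have t\<sigma>: "t \<le> \<sigma> x" if "x \<in> S" for x using fin that by (auto simp: t_def)
  have load': "load E y' x = load E y x + t * load E z x" for x
    unfolding y'_def by (simp add: load_add load_scale)
  have nonneg: "0 \<le> y' e" if "e \<in> E" for e
  proof (cases "z e < 0")
    case True
    then have "t * \<bar>z e\<bar> \<le> y e - of_int \<lfloor>y e\<rfloor>"
      using t\<tau>[of e] that by (auto simp: \<tau>_def D_def field_simps)
    moreover have "0 \<le> \<lfloor>y e\<rfloor>" using cov that by (simp add: covers_def)
    ultimately show ?thesis using True unfolding y'_def
      by (smt (verit) of_int_0_le_iff mult_minus_right)
  next
    case False
    then show ?thesis using cov that t_pos by (simp add: covers_def y'_def)
  qed
  have fulfil: "of_int (a x) \<le> load E y' x" if "x \<in> V" for x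
  proof (cases "load E z x < 0")
    case True
    then have "x \<in> S" using tight[of x] that by (auto simp: S_def)
    then have "t * (- load E z x) \<le> load E y x - of_int (a x)"
      using t\<sigma>[of x] True by (simp add: \<sigma>_def field_simps)
    then show ?thesis by (simp add: load')
  next
    case False
    then have "0 \<le> t * load E z x" using t_pos by simp
    then show ?thesis using cov that by (fastforce simp: covers_def load')
  qed
  have "x \<in> slack y" if "x \<in> slack y'" for x
    using that tight[of x] by (cases "x \<in> slack y") (auto simp: slack_def load')
  moreover have "nonint y' \<subseteq> nonint y" using supp by (auto simp: nonint_def y'_def)
  ultimately have sub: "nonint y' \<subseteq> nonint y" "slack y' \<subseteq> slack y" by auto
  have "t \<in> \<tau> ` D \<union> \<sigma> ` S" unfolding t_def using fin nemp by (rule Min_in)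
  then have "nonint y' \<noteq> nonint y \<or> slack y' \<noteq> slack y"
  proof
    assume "t \<in> \<tau> ` D"
    then obtain e where e: "e \<in> D" "t = \<tau> e" by auto
    then have "y' e = of_int \<lceil>y e\<rceil> \<or> y' e = of_int \<lfloor>y e\<rfloor>"
      by (auto simp: y'_def \<tau>_def D_def abs_if)
    then have "y' e \<in> \<int>" by auto
    then show ?thesis using nonint[OF e(1)] e(1) by (auto simp: nonint_def D_def)
  next
    assume "t \<in> \<sigma> ` S"
    then obtain x where x: "x \<in> S" "t = \<sigma> x" by auto
    then have "load E y' x = of_int (a x)" by (simp add: load' \<sigma>_def S_def)
    then have "x \<notin> slack y'" by (simp add: slack_def)
    then show ?thesis using x by (auto simp: S_def)
  qed
  then have "nonint y' \<subset> nonint y \<or> slack y' \<subset> slack y" using sub by auto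
  then have "defect y' < defect y"
    using sub psubset_card_mono[OF finite_nonint] psubset_card_mono[OF finite_slack]
      card_mono[OF finite_nonint sub(1)] card_mono[OF finite_slack sub(2)]
    unfolding defect_def by (metis add_le_less_mono add_less_le_mono)
  then show thesis using that[OF t_pos] nonneg fulfil unfolding y'_def covers_def by blast
qed

text \<open>If \<open>z\<close> were nonzero, both \<open>z\<close> and \<open>- z\<close> would be
  admissible directions. Optimality then makes the total of \<open>z\<close> zero, so the push along
  \<open>z\<close> keeps the value and lowers the defect, against the minimality of the
  defect.\<close>

lemma extremal_kernel:
  assumes ext: "extremal y"
    and supp: "\<And>e. e \<in> E \<Longrightarrow> y e \<in> \<int> \<Longrightarrow> z e = 0"
    and tight: "\<And>x. x \<in> V - slack y \<Longrightarrow> load E z x = 0"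
    and e: "e \<in> E"
  shows "z e = 0"
proof (rule ccontr)
  assume "z e \<noteq> 0"
  have cov: "covers E V a y" using ext by (simp add: extremal_def)
  have sum': "sum (\<lambda>e. y e + t * w e) E = sum y E + t * sum w E" for t and w :: "'a set \<Rightarrow> real"
    by (simp add: sum.distrib sum_distrib_left)
  obtain t where t: "0 < t" "covers E V a (\<lambda>e. y e + t * z e)" "defect (\<lambda>e. y e + t * z e) < defect y"
    using push[OF cov supp tight] \<open>z e \<noteq> 0\<close> e by blast
  have neg: "load E (\<lambda>e. - z e) x = - load E z x" for x
    using load_scale[of E "- 1" z x] by simp
  obtain s where s: "0 < s" "covers E V a (\<lambda>e. y e + s * - z e)"
  proof (rule push[OF cov, of "\<lambda>e. - z e"])
    show "- z f = 0" if "f \<in> E" "y f \<in> \<int>" for f using supp that by simp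
    show "load E (\<lambda>e. - z e) x = 0" if "x \<in> V - slack y" for x
      using tight[OF that] neg by simp
    show "\<exists>e\<in>E. - z e \<noteq> 0" using \<open>z e \<noteq> 0\<close> e by auto
  qed (rule that)
  have "sum y E \<le> sum y E + t * sum z E" "sum y E \<le> sum y E + s * sum (\<lambda>e. - z e) E"
    using ext t(2) s(2) sum' unfolding extremal_def by metis+
  then have "sum z E = 0" using t(1) s(1) by (simp add: sum_negf zero_le_mult_iff mult_le_0_iff)
  then have "sum (\<lambda>e. y e + t * z e) E = sum y E" using sum' by simp
  then show False using ext t unfolding extremal_def by (metis not_le)
qed

section \<open>Structure of the fractional edges of an extremal cover\<close>

lemma nonint_sum_at:
  assumes "covers E V a y" "x \<in> V - slack y"
  shows "(\<Sum>e | e \<in> nonint y \<and> x \<in> e. y e) \<in> \<int>"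
proof -
  have "load E y x = (\<Sum>e | e \<in> nonint y \<and> x \<in> e. y e) + (\<Sum>e | e \<in> E - nonint y \<and> x \<in> e. y e)"
    unfolding load_def using finite_E finite_nonint
    by (subst sum.union_disjoint[symmetric]) (auto simp: nonint_def intro!: sum.cong)
  moreover have "load E y x = of_int (a x)"
    using assms unfolding covers_def slack_def by force
  moreover have "(\<Sum>e | e \<in> E - nonint y \<and> x \<in> e. y e) \<in> \<int>"
    by (intro Ints_sum) (auto simp: nonint_def)
  ultimately show ?thesis by (metis Ints_diff Ints_of_int add_diff_cancel_right')
qed

lemma load_restrict:
  assumes "H \<subseteq> E"
  shows "load E (\<lambda>e. if e \<in> H then z e else 0) x = (\<Sum>e | e \<in> H \<and> x \<in> e. z e)"
proof -
  have "{e \<in> E. x \<in> e} \<inter> H = {e. e \<in> H \<and> x \<in> e}" using assms by auto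
  then show ?thesis unfolding load_def using finite_at[of x]
    by (simp add: sum.inter_restrict[symmetric])
qed

text \<open>By triviality of the kernel there are at most as many fractional edges as tight vertices
  on them; each such vertex has at least two fractional edges, so double counting forces equality.\<close>

lemma extremal_two_regular:
  assumes ext: "extremal y" and x: "x \<in> \<Union>(nonint y)"
  shows "x \<notin> slack y" "card {e \<in> nonint y. x \<in> e} = 2"
proof -
  let ?H = "nonint y"
  define U where "U = \<Union>?H"
  define d where "d x = card {e \<in> ?H. x \<in> e}" for x
  have cov: "covers E V a y" using ext by (simp add: extremal_def)
  have HE: "?H \<subseteq> E" by (auto simp: nonint_def)
  have UV: "U \<subseteq> V" using edges_sub HE by (auto simp: U_def)
  then have finU: "finite U" using finite_V finite_subset by blast
  have "card ?H \<le> card (U - slack y)"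
  proof (rule ccontr)
    assume "\<not> ?thesis"
    then have "card (U - slack y) < card ?H" by simp
    \<comment> \<open>One unknown per fractional edge and one equation per tight vertex on them:
      more unknowns than equations yield a nonzero perturbation.\<close>
    then obtain z where z: "\<exists>e\<in>?H. z e \<noteq> 0"
      "\<And>x. x \<in> U - slack y \<Longrightarrow> (\<Sum>e\<in>?H. of_bool (x \<in> e) * z e) = (0 :: real)"
      using homogeneous_system_solution[OF finite_Diff[OF finU] finite_nonint,
          of "slack y" y "\<lambda>x e. of_bool (x \<in> e)"] by blast
    have eq: "(\<Sum>e | e \<in> ?H \<and> x \<in> e. z e) = (\<Sum>e\<in>?H. of_bool (x \<in> e) * z e)" for x
      using finite_nonint[of y]
      by (simp add: sum.inter_filter[of ?H z "\<lambda>e. x \<in> e", simplified] of_bool_def if_distrib[of "\<lambda>b. b * _"] cong: if_cong)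
    have "load E (\<lambda>e. if e \<in> ?H then z e else 0) x = 0" if "x \<in> V - slack y" for x
    proof (cases "x \<in> U")
      case True
      then show ?thesis using z(2)[of x] that eq load_restrict[OF HE] by simp
    next
      case False
      then have "{e. e \<in> ?H \<and> x \<in> e} = {}" by (auto simp: U_def)
      then show ?thesis by (simp only: load_restrict[OF HE] sum.empty)
    qed
    then have "(if e \<in> ?H then z e else 0) = 0" if "e \<in> E" for e
      using extremal_kernel[OF ext, of "\<lambda>e. if e \<in> ?H then z e else 0" e] that
      by (auto simp: nonint_def)
    then show False using z(1) HE by (metis subsetD)
  qed
  moreover have "(\<Sum>x\<in>U. d x) = 2 * card ?H"
    unfolding d_def using finU finite_nonint[of y]
  proof (rule sum_multicount)
    show "\<forall>e\<in>?H. card {x \<in> U. x \<in> e} = 2"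
    proof
      fix e assume "e \<in> ?H"
      then have "{x \<in> U. x \<in> e} = e" by (auto simp: U_def)
      then show "card {x \<in> U. x \<in> e} = 2" using card_edge \<open>e \<in> ?H\<close> HE by auto
    qed
  qed
  moreover have d1: "1 \<le> d x" if "x \<in> U" for x
  proof -
    have "{e \<in> ?H. x \<in> e} \<noteq> {}" using that by (auto simp: U_def)
    then show ?thesis unfolding d_def using finite_nonint[of y]
      by (simp add: Suc_le_eq card_gt_0_iff)
  qed
  \<comment> \<open>A single fractional edge at a tight vertex would have an integral weight, since
    all other terms of the integral load are integers.\<close>
  moreover have d2: "2 \<le> d x" if "x \<in> U - slack y" for x
  proof (rule ccontr)
    assume "\<not> ?thesis"
    then have "d x = 1" using d1[of x] that by simp
    then obtain e where e: "{e \<in> ?H. x \<in> e} = {e}" unfolding d_def by (rule card_1_singletonE)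
    then have "y e \<in> \<int>" using nonint_sum_at[OF cov, of x] that UV by auto
    then show False using e by (auto simp: nonint_def)
  qed
  ultimately have le: "(\<Sum>x\<in>U. d x) \<le> 2 * card (U - slack y)" by simp
  have split: "(\<Sum>x\<in>U. f x) = (\<Sum>x\<in>U - slack y. f x) + (\<Sum>x\<in>U \<inter> slack y. f x)" for f :: "'a \<Rightarrow> nat"
    using finU by (metis Int_Diff_Un Int_Diff_disjoint add.commute finite_Diff finite_Int sum.union_disjoint)
  have ge: "2 * card (U - slack y) \<le> (\<Sum>x\<in>U - slack y. d x)"
    using sum_mono[of "U - slack y" "\<lambda>_. 2" d] d2 by simp
  \<comment> \<open>The tight vertices already exhaust the double count, while every slack vertex of
    \<open>U\<close> would add at least one; hence there is none.\<close>
  have "card (U \<inter> slack y) \<le> (\<Sum>x\<in>U \<inter> slack y. d x)"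
    using sum_mono[of "U \<inter> slack y" "\<lambda>_. 1" d] d1 by simp
  then have "card (U \<inter> slack y) = 0" using le ge split[of d] by linarith
  then have emp: "U \<inter> slack y = {}" using finU by simp
  then show "x \<notin> slack y" using x by (auto simp: U_def)
  have US: "U - slack y = U" using emp by auto
  show "card {e \<in> ?H. x \<in> e} = 2"
  proof (rule ccontr)
    assume ne: "\<not> ?thesis"
    have xU: "x \<in> U" using x by (simp add: U_def)
    then have "2 \<le> d x" using d2[of x] US by simp
    then have "2 < d x" using ne by (simp add: d_def)
    then have "(\<Sum>x\<in>U. 2) < (\<Sum>x\<in>U. d x)"
      using xU d2 US finU by (intro sum_strict_mono_ex1) auto
    then show False using le US by simp
  qed
qed

text \<open>The deviation of the fractional parts from \<open>1 / 2\<close> is a kernel direction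
  and therefore zero: the two fractional parts at a vertex lie strictly between 0 and 1 and have an
  integral sum, which must be 1.\<close>

lemma extremal_half:
  assumes ext: "extremal y" and e: "e \<in> nonint y"
  shows "frac (y e) = 1 / 2"
proof -
  let ?H = "nonint y"
  let ?z = "\<lambda>e. if e \<in> ?H then frac (y e) - 1 / 2 else 0"
  have cov: "covers E V a y" using ext by (simp add: extremal_def)
  have HE: "?H \<subseteq> E" by (auto simp: nonint_def)
  have load0: "load E ?z x = 0" if "x \<in> V - slack y" for x
  proof (cases "x \<in> \<Union>?H")
    case True
    then obtain e1 e2 where e12: "{e \<in> ?H. x \<in> e} = {e1, e2}" "e1 \<noteq> e2"
      using extremal_two_regular(2)[OF ext True] by (auto simp: card_2_iff)
    then have "y e1 + y e2 \<in> \<int>" using nonint_sum_at[OF cov that] by simp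
    then have int: "frac (y e1) + frac (y e2) \<in> \<int>"
      using Ints_diff[of "y e1 + y e2" "of_int (\<lfloor>y e1\<rfloor> + \<lfloor>y e2\<rfloor>)"]
      by (simp add: frac_def algebra_simps)
    have "e1 \<in> ?H" "e2 \<in> ?H" using e12(1) by auto
    then have "0 < frac (y e1)" "0 < frac (y e2)"
      by (auto simp: nonint_def)
    moreover have "frac (y e1) < 1" "frac (y e2) < 1" by (simp_all add: frac_lt_1)
    moreover obtain k where k: "frac (y e1) + frac (y e2) = of_int k" using int by (auto elim: Ints_cases)
    ultimately have "0 < k" "k < 2" by linarith+
    then have "k = 1" by simp
    then show ?thesis using e12 k by (subst load_restrict[OF HE]) simp
  next
    case False
    then have "{e. e \<in> ?H \<and> x \<in> e} = {}" by auto
    then show ?thesis by (simp only: load_restrict[OF HE] sum.empty)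
  qed
  have int0: "?z f = 0" if "f \<in> E" "y f \<in> \<int>" for f using that by (simp add: nonint_def)
  have "e \<in> E" using e HE by blast
  then have "?z e = 0" using extremal_kernel[OF ext, of ?z e, OF int0 load0] by simp
  then show ?thesis using e by simp
qed

text \<open>Alternating \<open>1, - 1\<close> around an even cycle changes no load and would be a
  nonzero kernel direction.\<close>

lemma extremal_odd_cycle:
  assumes ext: "extremal y" and c: "cycle_in (nonint y) c"
  shows "odd (length c)"
proof (rule ccontr)
  assume "\<not> ?thesis"
  then have even: "even (length c)" by simp
  let ?W = "walk_edges (c @ [hd c])"
  let ?z = "alternating 1 (c @ [hd c])"
  have cE: "cycle_in E c" using c by (rule cycle_in_mono) (auto simp: nonint_def)
  have "length ?W \<noteq> 0" using c by (auto simp: length_walk_edges cycle_in_def)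
  then obtain e where e: "e \<in> set ?W" by (metis length_0_conv list.set_intros(1) neq_Nil_conv)
  have W: "set ?W \<subseteq> nonint y" using c by (simp add: cycle_in_def)
  have "distinct ?W" using c distinct_walk_edges_cycle by (auto simp: cycle_in_def)
  then have "?z e \<noteq> 0" using alternating_in[OF _ e, of 1] by auto
  moreover have "?z e = 0"
  proof (rule extremal_kernel[OF ext])
    show "?z f = 0" if "f \<in> E" "y f \<in> \<int>" for f
      using that W by (intro alternating_notin) (auto simp: nonint_def)
    show "load E ?z x = 0" for x using load_alternating_cycle[OF cE] even by simp
    show "e \<in> E" using e W by (auto simp: nonint_def)
  qed
  ultimately show False by simp
qed

text \<open>A vertex of \<open>c\<close> has exactly two fractional edges, and both belong to
  \<open>c\<close>. The remaining fractional edges thus avoid \<open>c\<close> and still come in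
  pairs at each of their vertices, so they contain a cycle.\<close>

lemma extremal_disjoint_cycle:
  assumes ext: "extremal y" and c: "cycle_in (nonint y) c"
    and ne: "nonint y - set (walk_edges (c @ [hd c])) \<noteq> {}"
  obtains c' where "cycle_in (nonint y) c'" "set c \<inter> set c' = {}"
proof -
  let ?H = "nonint y"
  let ?W = "set (walk_edges (c @ [hd c]))"
  have HE: "?H \<subseteq> E" by (auto simp: nonint_def)
  have cE: "cycle_in E c" using c HE by (rule cycle_in_mono)
  have WH: "?W \<subseteq> ?H" using c by (simp add: cycle_in_def)
  have Wc: "e \<subseteq> set c" if "e \<in> ?W" for e
    using walk_edges_subset[OF that] c by (cases c) (auto simp: cycle_in_def)
  have off: "x \<notin> set c" if "e \<in> ?H - ?W" "x \<in> e" for e x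
  proof
    assume "x \<in> set c"
    then have "card {e \<in> ?W. x \<in> e} = 2" by (rule card_cycle_edges_at[OF cE])
    moreover have "card {e \<in> ?H. x \<in> e} = 2"
      using extremal_two_regular(2)[OF ext, of x] that by auto
    moreover have "{e \<in> ?W. x \<in> e} \<subseteq> {e \<in> ?H. x \<in> e}" using WH by auto
    ultimately have "{e \<in> ?W. x \<in> e} = {e \<in> ?H. x \<in> e}"
      using finite_nonint[of y] by (intro card_subset_eq) auto
    then show False using that by auto
  qed
  obtain c' where c': "cycle_in (?H - ?W) c'"
  proof (rule exists_cycle_in[of "?H - ?W"])
    fix x e assume e: "e \<in> ?H - ?W" "x \<in> e"
    have "card {e \<in> ?H. x \<in> e} = 2"
      using extremal_two_regular(2)[OF ext, of x] e by auto
    then obtain e' where "e' \<in> ?H" "x \<in> e'" "e' \<noteq> e" 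
      by (metis (no_types, lifting) card_2_iff' mem_Collect_eq)
    then show "\<exists>e'\<in>?H - ?W. e' \<noteq> e \<and> x \<in> e'" using off[OF e] Wc by blast
  next
    show "finite (?H - ?W)" using finite_nonint by blast
    show "card e = 2" if "e \<in> ?H - ?W" for e using that HE card_edge by blast
  qed (rule ne, rule that)
  have "x \<notin> set c" if "x \<in> set c'" for x
  proof -
    have "cycle_in E c'" using c' HE by (meson Diff_subset cycle_in_mono subset_trans)
    then have "{e \<in> set (walk_edges (c' @ [hd c'])). x \<in> e} \<noteq> {}"
      using card_cycle_edges_at[of c' x] that by force
    then show ?thesis using off c' by (auto simp: cycle_in_def)
  qed
  then show thesis using that[of c'] c' by (meson Diff_subset cycle_in_mono disjoint_iff)
qed

text \<open>Alternating \<open>- 1 / 2, + 1 / 2\<close> along an odd cycle lowers the load of its root by one, which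
  the edge joining the two roots restores; the total weight does not change.\<close>

lemma extremal_no_adjacent_cycles:
  assumes ext: "extremal y" and c: "cycle_in (nonint y) c" "cycle_in (nonint y) c'"
    and disj: "set c \<inter> set c' = {}" and uv: "u \<in> set c" "v \<in> set c'"
  shows "{u, v} \<notin> E"
proof
  assume uvE: "{u, v} \<in> E"
  obtain p where p: "cycle_in (nonint y) p" "hd p = u" "set p = set c"
    using cycle_in_rooted[OF c(1) uv(1)] by metis
  obtain q where q: "cycle_in (nonint y) q" "hd q = v" "set q = set c'"
    using cycle_in_rooted[OF c(2) uv(2)] by metis
  let ?P = "walk_edges (p @ [hd p])" and ?Q = "walk_edges (q @ [hd q])"
  have HE: "nonint y \<subseteq> E" by (auto simp: nonint_def)
  have pE: "cycle_in E p" and qE: "cycle_in E q" using p(1) q(1) HE cycle_in_mono by blast+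
  have P: "set ?P \<subseteq> nonint y" "distinct ?P" and Q: "set ?Q \<subseteq> nonint y" "distinct ?Q"
    using p(1) q(1) distinct_walk_edges_cycle by (auto simp: cycle_in_def)
  have odd: "odd (length p)" "odd (length q)" using extremal_odd_cycle[OF ext] p q by auto
  have ne: "p \<noteq> []" "q \<noteq> []" using p(1) q(1) by (auto simp: cycle_in_def)
  define z1 where "z1 = alternating (- 1 / 2) (p @ [hd p])"
  define z2 where "z2 = alternating (- 1 / 2) (q @ [hd q])"
  define z3 :: "'a set \<Rightarrow> real" where "z3 e = (if e = {u, v} then 1 else 0)" for e
  define y' where "y' e = y e + (z1 e + (z2 e + z3 e))" for e
  have cov: "covers E V a y" using ext by (simp add: extremal_def)
  \<comment> \<open>A common edge would lie inside both vertex sets and be empty.\<close>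
  have PQ: "e \<notin> set ?Q" if "e \<in> set ?P" for e
  proof
    assume "e \<in> set ?Q"
    then have "e \<subseteq> set q" using walk_edges_subset[of e "q @ [hd q]"] ne by auto
    moreover have "e \<subseteq> set p" using walk_edges_subset[OF that] ne by auto
    ultimately have "e = {}" using p(3) q(3) disj by auto
    then show False using card_edge[of e] that P(1) HE by auto
  qed
  \<comment> \<open>The joining edge is left out here: its contribution \<open>z3\<close> is a
    nonnegative integer and affects neither claim.\<close>
  have half: "0 \<le> y e + z1 e + z2 e" "e \<in> set ?P \<union> set ?Q \<or> y e \<in> \<int> \<Longrightarrow> y e + z1 e + z2 e \<in> \<int>"
    if "e \<in> E" for e
  proof -
    have "e \<in> set ?P \<and> z2 e = 0 \<and> (z1 e = 1 / 2 \<or> z1 e = - 1 / 2)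
      \<or> e \<in> set ?Q \<and> z1 e = 0 \<and> (z2 e = 1 / 2 \<or> z2 e = - 1 / 2)
      \<or> e \<notin> set ?P \<union> set ?Q \<and> z1 e = 0 \<and> z2 e = 0"
      using alternating_in[OF P(2), of e "- 1 / 2"] alternating_in[OF Q(2), of e "- 1 / 2"]
        alternating_notin[of e "p @ [hd p]" "- 1 / 2"] alternating_notin[of e "q @ [hd q]" "- 1 / 2"]
        PQ[of e] unfolding z1_def z2_def by auto
    moreover have "0 \<le> y e" using cov that by (simp add: covers_def)
    moreover have "frac (y e) = 1 / 2" if "e \<in> set ?P \<union> set ?Q"
      using extremal_half[OF ext] that P Q by auto
    ultimately show "0 \<le> y e + z1 e + z2 e"
      "e \<in> set ?P \<union> set ?Q \<or> y e \<in> \<int> \<Longrightarrow> y e + z1 e + z2 e \<in> \<int>"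
      using frac_half[of "y e" "z1 e"] frac_half[of "y e" "z2 e"] by auto
  qed
  have load': "load E y' x = load E y x" for x
  proof -
    have "load E y' x = load E y x + (load E z1 x + (load E z2 x + load E z3 x))"
      unfolding y'_def by (simp add: load_add)
    also have "load E z3 x = of_bool (x = u) + of_bool (x = v)"
      unfolding z3_def using load_single[OF uvE] by simp
    finally show ?thesis
      unfolding z1_def z2_def load_alternating_cycle[OF pE] load_alternating_cycle[OF qE]
      using odd p q by auto
  qed
  have "sum y' E = sum y E + (sum z1 E + (sum z2 E + sum z3 E))"
    by (simp add: y'_def sum.distrib)
  moreover have "sum z1 E = - 1 / 2" "sum z2 E = - 1 / 2"
    unfolding z1_def z2_def using pE qE odd by (subst sum_alternating; simp add: cycle_in_def)+
  moreover have "sum z3 E = 1" unfolding z3_def using uvE finite_E by simp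
  ultimately have sum': "sum y' E = sum y E" by simp
  have z3: "0 \<le> z3 e" "z3 e \<in> \<int>" for e by (auto simp: z3_def)
  have y': "y' e = (y e + z1 e + z2 e) + z3 e" for e by (simp add: y'_def)
  have "covers E V a y'"
    unfolding covers_def load' using cov half(1) z3(1) by (auto simp: covers_def y')
  then have "defect y \<le> defect y'" using ext sum' by (auto simp: extremal_def)
  moreover have "slack y' = slack y" by (simp add: slack_def load')
  moreover have "card (nonint y') < card (nonint y)"
  proof (rule psubset_card_mono[OF finite_nonint])
    \<comment> \<open>Making the edges of one of the two cycles integral is enough for a strict
      inclusion.\<close>
    have sub: "nonint y' \<subseteq> nonint y - set ?P"
      using half(2) z3(2) by (auto simp: nonint_def y')
    have "set ?P \<noteq> {}" using ne by (cases p rule: remdups_adj.cases) auto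
    then obtain f where f: "f \<in> set ?P" by (metis ex_in_conv)
    have "f \<in> nonint y" "f \<notin> nonint y'" using f sub P(1) by auto
    then show "nonint y' \<subset> nonint y" using sub by auto
  qed
  ultimately show False by (simp add: defect_def)
qed

section \<open>Rounding an extremal cover\<close>

lemma extremal_rounding:
  assumes ext: "extremal y" and min: "sum y E = m"
    and y': "covers E V a y'" "\<And>e. e \<in> E \<Longrightarrow> y' e \<in> \<int>" "sum y' E < m + 1"
  shows "is_min (int_cover_values E V a) (of_int \<lceil>m\<rceil>)"
proof -
  \<comment> \<open>The value of an integral cover is an integer that is at least \<open>m\<close>,
    hence at least its ceiling.\<close>
  have low: "of_int \<lceil>m\<rceil> \<le> sum w E" if "covers E V a w" "\<And>e. e \<in> E \<Longrightarrow> w e \<in> \<int>" for w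
  proof -
    have "sum w E \<in> \<int>" using that by (intro Ints_sum)
    then obtain k where k: "sum w E = of_int k" by (auto elim: Ints_cases)
    have "m \<le> sum w E" using ext min that by (auto simp: extremal_def)
    then show ?thesis using k by (simp add: ceiling_le_iff)
  qed
  have "sum y' E \<in> \<int>" using y' by (intro Ints_sum)
  then obtain k where k: "sum y' E = of_int k" by (auto elim: Ints_cases)
  have "k \<le> \<lceil>m\<rceil>" using y'(3) k by linarith
  then have "sum y' E = of_int \<lceil>m\<rceil>" using low[OF y'(1,2)] k by simp
  then have "of_int \<lceil>m\<rceil> \<in> int_cover_values E V a"
    unfolding int_cover_values_def using y'(1,2) by (intro CollectI exI[of _ y']) auto
  then show ?thesis using low by (auto simp: is_min_def int_cover_values_def)
qed

lemma rounding_if_cycles_adjacent: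
  assumes adj: "\<And>c c'. cycle_in E c \<Longrightarrow> cycle_in E c' \<Longrightarrow> odd (length c) \<Longrightarrow> odd (length c') \<Longrightarrow>
      set c \<inter> set c' = {} \<Longrightarrow> \<exists>u\<in>set c. \<exists>v\<in>set c'. {u, v} \<in> E"
    and min: "is_min (cover_values E V a) m"
  shows "is_min (int_cover_values E V a) (of_int \<lceil>m\<rceil>)"
proof -
  obtain y where ext: "extremal y" and sum: "sum y E = m" using exists_extremal[OF min] .
  have cov: "covers E V a y" using ext by (simp add: extremal_def)
  have HE: "nonint y \<subseteq> E" by (auto simp: nonint_def)
  show ?thesis
  proof (cases "nonint y = {}")
    case True
    then have "y e \<in> \<int>" if "e \<in> E" for e using that by (auto simp: nonint_def)
    then show ?thesis using extremal_rounding[OF ext sum cov] sum by simp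
  next
    case False
    obtain c where c: "cycle_in (nonint y) c"
    proof (rule exists_cycle_in[OF finite_nonint _ False])
      fix x e assume e: "e \<in> nonint y" "x \<in> e"
      then have "card {e \<in> nonint y. x \<in> e} = 2"
        using extremal_two_regular(2)[OF ext, of x] by auto
      then show "\<exists>e'\<in>nonint y. e' \<noteq> e \<and> x \<in> e'"
        by (metis (no_types, lifting) card_2_iff' mem_Collect_eq)
    next
      show "card e = 2" if "e \<in> nonint y" for e using that HE card_edge by blast
    qed (rule that)
    let ?W = "walk_edges (c @ [hd c])"
    have cE: "cycle_in E c" using c HE by (rule cycle_in_mono)
    have odd: "odd (length c)" by (rule extremal_odd_cycle[OF ext c])
    \<comment> \<open>A fractional edge off \<open>c\<close> would produce a second, disjoint odd
      cycle; the hypothesis joins the two by an edge, which extremality forbids.\<close>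
    have W: "set ?W = nonint y"
    proof (rule ccontr)
      assume "set ?W \<noteq> nonint y"
      then have "nonint y - set ?W \<noteq> {}" using c by (auto simp: cycle_in_def)
      then obtain c' where c': "cycle_in (nonint y) c'" "set c \<inter> set c' = {}"
        using extremal_disjoint_cycle[OF ext c] by metis
      have "cycle_in E c'" using c'(1) HE by (rule cycle_in_mono)
      then show False
        using adj[OF cE _ odd] extremal_odd_cycle[OF ext] extremal_no_adjacent_cycles[OF ext c] c'
        by blast
    qed
    have dist: "distinct ?W" using c distinct_walk_edges_cycle by (auto simp: cycle_in_def)
    \<comment> \<open>Starting with the positive sign raises the load of the root by one instead of
      lowering it; as the number of edges is odd, the cost is \<open>1 / 2\<close>.\<close>
    define z where "z = alternating (1 / 2) (c @ [hd c])"
    have z: "0 \<le> y e + z e" "y e + z e \<in> \<int>" if "e \<in> E" for e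
    proof -
      have "e \<in> nonint y \<and> (z e = 1 / 2 \<or> z e = - 1 / 2) \<or> y e \<in> \<int> \<and> z e = 0"
        using alternating_in[OF dist, of e "1 / 2"] alternating_notin[of e "c @ [hd c]" "1 / 2"]
          that unfolding z_def W by (auto simp: nonint_def)
      moreover have "0 \<le> y e" using cov that by (simp add: covers_def)
      ultimately show "0 \<le> y e + z e" "y e + z e \<in> \<int>"
        using frac_half[of "y e" "z e"] extremal_half[OF ext] by auto
    qed
    have "0 \<le> load E z x" for x unfolding z_def load_alternating_cycle[OF cE] by simp
    moreover have "of_int (a x) \<le> load E y x" if "x \<in> V" for x
      using cov that by (simp add: covers_def)
    ultimately have "covers E V a (\<lambda>e. y e + z e)"
      using z(1) by (simp add: covers_def load_add add_increasing2)
    moreover have "sum (\<lambda>e. y e + z e) E = m + 1 / 2"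
      unfolding z_def sum.distrib sum using cE odd by (subst sum_alternating) (auto simp: cycle_in_def)
    ultimately show ?thesis using extremal_rounding[OF ext sum _ z(2)] by simp
  qed
qed

end

section \<open>Failure of rounding for two odd cycles joined by no edge\<close>

lemma (in edge_set) cycles_adjacent_if_rounding:
  assumes V: "finite V" "\<Union>E \<subseteq> V"
    and rounding: "\<And>a m. is_min (cover_values E V a) m \<Longrightarrow> is_min (int_cover_values E V a) (of_int \<lceil>m\<rceil>)"
    and c: "cycle_in E c" "cycle_in E c'" "odd (length c)" "odd (length c')" "set c \<inter> set c' = {}"
  shows "\<exists>u\<in>set c. \<exists>v\<in>set c'. {u, v} \<in> E"
proof (rule ccontr)
  assume no: "\<not> ?thesis"
  define W where "W = set c \<union> set c'"
  define a :: "'a \<Rightarrow> int" where "a x = of_bool (x \<in> W)" for x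
  define m where "m = real (length c + length c') / 2"
  have finW: "finite W" by (simp add: W_def)
  have "x \<in> V" if "x \<in> W" for x
  proof -
    have "\<exists>d. cycle_in E d \<and> x \<in> set d" using that c(1,2) unfolding W_def by blast
    then obtain d where d: "cycle_in E d" "x \<in> set d" by blast
    then have "{e \<in> set (walk_edges (d @ [hd d])). x \<in> e} \<noteq> {}"
      using card_cycle_edges_at[of d x] by force
    then show ?thesis using d V by (auto simp: cycle_in_def)
  qed
  then have WV: "W \<subseteq> V" by auto
  have cardW: "real (card W) = 2 * m"
    using c by (auto simp: W_def m_def card_Un_disjoint distinct_card cycle_in_def)
  have fin_e: "finite e" and le2: "card (e \<inter> W) \<le> 2" if "e \<in> E" for e
  proof -
    show "finite e" using card_edge[OF that] by (simp add: card_ge_0_finite)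
    then show "card (e \<inter> W) \<le> 2" using card_mono[of e "e \<inter> W"] card_edge[OF that] by simp
  qed
  \<comment> \<open>Weak duality with the dual weight \<open>1 / 2\<close> on each vertex of
    \<open>W\<close>: every such vertex demands 1, and an edge has at most two ends in
    \<open>W\<close>.\<close>
  have dual: "2 * m \<le> (\<Sum>x\<in>W. load E y x)" "(\<Sum>x\<in>W. load E y x) \<le> 2 * sum y E"
    if y: "covers E V a y" for y
  proof -
    have "(\<Sum>x\<in>W. 1) \<le> (\<Sum>x\<in>W. load E y x)"
      using y WV by (intro sum_mono) (force simp: covers_def a_def)
    then show "2 * m \<le> (\<Sum>x\<in>W. load E y x)" using cardW by simp
    show "(\<Sum>x\<in>W. load E y x) \<le> 2 * sum y E"
      unfolding sum_load[OF finW] sum_distrib_left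
    proof (rule sum_mono)
      fix e assume "e \<in> E"
      then have "card (e \<inter> W) \<le> 2" "0 \<le> y e"
        using le2 y by (auto simp: covers_def)
      then show "y e * real (card (e \<inter> W)) \<le> 2 * y e"
        by (subst mult.commute) (intro mult_right_mono, auto)
    qed
  qed
  define cnt where "cnt d e = real (count_list (walk_edges (d @ [hd d])) e)" for d and e :: "'a set"
  \<comment> \<open>Two cycle edges of weight \<open>1 / 2\<close> meet at each vertex of
    \<open>W\<close>, so its demand is met exactly and the dual bound is attained.\<close>
  define y where "y e = 1 / 2 * (cnt c e + cnt c' e)" for e
  have "covers E V a y"
    unfolding covers_def
  proof (intro conjI ballI)
    fix x
    have "load E y x = of_bool (x \<in> set c) + of_bool (x \<in> set c')"
      unfolding y_def load_scale load_add cnt_def load_count_cycle[OF c(1)] load_count_cycle[OF c(2)]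
      by simp
    then show "of_int (a x) \<le> load E y x" by (auto simp: a_def W_def)
  qed (auto simp: y_def cnt_def)
  moreover have "sum y E = m"
  proof -
    have "sum y E = 1 / 2 * (sum (cnt c) E + sum (cnt c') E)"
      unfolding y_def by (simp only: sum_distrib_left[symmetric] sum.distrib)
    then show ?thesis unfolding cnt_def using c sum_count[of "c @ [hd c]"] sum_count[of "c' @ [hd c']"]
      by (simp add: cycle_in_def m_def)
  qed
  ultimately have "is_min (cover_values E V a) m"
    using dual unfolding is_min_def cover_values_def by fastforce
  then have "is_min (int_cover_values E V a) (of_int \<lceil>m\<rceil>)" by (rule rounding)
  \<comment> \<open>The sum of two odd lengths is even, so rounding up changes nothing and an
    integral cover of value \<open>m\<close> itself must exist.\<close>
  moreover have "of_int \<lceil>m\<rceil> = m"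
  proof -
    have "even (length c + length c')" using c by simp
    then have "m = of_int (int ((length c + length c') div 2))"
      unfolding m_def by (simp add: real_of_nat_div)
    then show ?thesis by (metis ceiling_of_int)
  qed
  ultimately obtain w where w: "covers E V a w" "\<And>e. e \<in> E \<Longrightarrow> w e \<in> \<int>" "sum w E = m"
    unfolding is_min_def int_cover_values_def by auto
  have w0: "0 \<le> w e" if "e \<in> E" for e using w(1) that by (simp add: covers_def)
  \<comment> \<open>Complementary slackness: equality throughout the duality bound makes each
    nonnegative excess over the demand on \<open>W\<close> zero.\<close>
  have tight: "load E w x = 1" if "x \<in> W" for x
  proof -
    have "(\<Sum>x\<in>W. load E w x - 1) = 0" using dual[OF w(1)] w(3) cardW by (simp add: sum_subtractf)
    moreover have "0 \<le> load E w x - 1" if "x \<in> W" for x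
      using w(1) that WV by (force simp: covers_def a_def)
    ultimately show ?thesis using that finW by (subst (asm) sum_nonneg_eq_0_iff) auto
  qed
  \<comment> \<open>Likewise on the edge side: an edge of positive weight must have both ends in
    \<open>W\<close>.\<close>
  have used: "w e = 0 \<or> e \<subseteq> W" if "e \<in> E" for e
  proof -
    have le: "0 \<le> w e * (2 - real (card (e \<inter> W)))" if "e \<in> E" for e
      using w0[OF that] le2[OF that] by (intro mult_nonneg_nonneg) auto
    have "(\<Sum>e\<in>E. w e * (2 - real (card (e \<inter> W)))) = 2 * sum w E - (\<Sum>x\<in>W. load E w x)"
      unfolding sum_load[OF finW] by (simp add: right_diff_distrib sum_subtractf sum_distrib_right mult.commute)
    also have "\<dots> = 0" using dual[OF w(1)] w(3) by simp
    finally have "w e * (2 - real (card (e \<inter> W))) = 0"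
      using le finite_E that by (subst (asm) sum_nonneg_eq_0_iff) auto
    then have "w e = 0 \<or> card (e \<inter> W) = card e" using card_edge[OF that] by auto
    then show ?thesis using card_subset_eq[OF fin_e[OF that], of "e \<inter> W"] by auto
  qed
  \<comment> \<open>No edge joins the two cycles, so an edge of nonzero weight has either no end or
    both ends on \<open>c\<close>.\<close>
  have "\<exists>k. w e * real (card (e \<inter> set c)) = 2 * of_int k" if eE: "e \<in> E" for e
  proof -
    obtain p q where e: "e = {p, q}" using card_edge[OF eE] by (auto simp: card_2_iff)
    obtain l where l: "w e = of_int l" using w(2)[OF eE] by (auto elim: Ints_cases)
    have "w e = 0 \<or> e \<inter> set c = {} \<or> e \<inter> set c = e"
      using used[OF eE] no c(5) eE unfolding e W_def
      by (auto simp: insert_commute)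
    then show ?thesis
    proof (elim disjE)
      assume "e \<inter> set c = e"
      then show ?thesis using card_edge[OF eE] l by (intro exI[of _ l]) simp
    qed (auto intro: exI[of _ 0])
  qed
  then obtain k where k: "\<And>e. e \<in> E \<Longrightarrow> w e * real (card (e \<inter> set c)) = 2 * of_int (k e)" by metis
  \<comment> \<open>Counting the unit loads on \<open>c\<close> edge by edge writes its odd length
    as an even integer.\<close>
  have "real (length c) = (\<Sum>x\<in>set c. load E w x)"
    using tight c by (simp add: W_def distinct_card cycle_in_def)
  also have "\<dots> = (\<Sum>e\<in>E. 2 * of_int (k e))" unfolding sum_load[OF finite_set] using k by simp
  also have "\<dots> = of_int (2 * (\<Sum>e\<in>E. k e))" by (simp add: sum_distrib_left)
  finally have "int (length c) = 2 * (\<Sum>e\<in>E. k e)" by linarith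
  then show False using c(3) by presburger
qed

section \<open>Cycles and connectivity in the graph\<close>

lemma (in pair_graph) edges_iff: "{u, v} \<in> edges G \<longleftrightarrow> (u, v) \<in> parcs G"
  using arcs_symmetric by (auto simp: edges_def doubleton_eq_iff)

lemma edges_image: "edges G = (\<lambda>(u, v). {u, v}) ` parcs G"
  by (auto simp: edges_def)

lemma (in pair_graph) edge_set_edges: "edge_set (edges G)"
proof
  show "finite (edges G)" using pair_finite_arcs by (simp add: edges_image)
  show "card e = 2" if e: "e \<in> edges G" for e
  proof -
    obtain u v where "e = {u, v}" "(u, v) \<in> parcs G" using e by (auto simp: edges_def)
    then show ?thesis using no_loops'[of u v] by simp
  qed
qed

lemma (in pair_graph) edges_subset: "\<Union>(edges G) \<subseteq> pverts G"
  using wellformed' by (auto simp: edges_def)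

lemma pawalk_verts_conv:
  "pcas u p v \<Longrightarrow> pawalk_verts u p = map fst p @ [v]"
  "pcas u p v \<Longrightarrow> pawalk_verts u p = u # map snd p"
  by (induction p arbitrary: u) auto

lemma walk_edges_pawalk_verts:
  "pcas u p v \<Longrightarrow> set (walk_edges (pawalk_verts u p)) = (\<lambda>(a, b). {a, b}) ` set p"
proof (induction p arbitrary: u)
  case (Cons e p)
  then show ?case by (cases e; cases p) auto
qed simp

text \<open>The first components of the arcs list each vertex of the closed walk once, beginning
  with its starting point.\<close>

lemma (in pair_graph) cycle_in_of_odd_cycle:
  assumes "odd_cycle G p"
  obtains c where "cycle_in (edges G) c" "odd (length c)" "set c = cycle_verts p"
proof -
  obtain u where u: "pcas u p u" "set p \<subseteq> parcs G" "distinct (tl (pawalk_verts u p))" "p \<noteq> []"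
    "odd (length p)"
    using assms unfolding odd_cycle_def cycle_def awalk_def by auto
  note conv = pawalk_verts_conv[OF u(1)]
  define c where "c = map fst p"
  have c: "c @ [u] = u # map snd p" "pawalk_verts u p = c @ [u]" using conv by (auto simp: c_def)
  have "c \<noteq> []" "length c = length p" using u by (auto simp: c_def)
  have hd: "hd c = u" using c(1) \<open>c \<noteq> []\<close> by (metis hd_append2 list.sel(1))
  have "distinct (tl c @ [u])" using u(3) c(2) \<open>c \<noteq> []\<close> by simp
  then have dist: "distinct c" using hd \<open>c \<noteq> []\<close> by (cases c) auto
  \<comment> \<open>A closed walk with one arc would be a loop; with odd length this leaves at least
    three arcs.\<close>
  have "length p \<noteq> 1"
  proof
    assume "length p = 1"
    then obtain e where "p = [e]" by (metis One_nat_def length_0_conv length_Suc_conv)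
    then show False using u no_loops' by (cases e) auto
  qed
  then have "3 \<le> length c" using u(5) \<open>length c = length p\<close> by (cases "length p = 2") (auto simp: numeral_3_eq_3 Suc_le_eq elim: oddE)
  moreover have "set (walk_edges (c @ [hd c])) \<subseteq> edges G"
    using walk_edges_pawalk_verts[OF u(1)] image_mono[OF u(2)] c(2) hd by (simp add: edges_image)
  ultimately have "cycle_in (edges G) c" using dist by (simp add: cycle_in_def)
  moreover have "set c = cycle_verts p"
  proof -
    have "insert u (set c) = insert u (snd ` set p)"
      using arg_cong[OF c(1), of set] by simp
    moreover have "u \<in> set c" using hd \<open>c \<noteq> []\<close> by auto
    ultimately show ?thesis by (auto simp: cycle_verts_def c_def)
  qed
  ultimately show thesis using that u(5) \<open>length c = length p\<close> by simp
qed

lemma vwalk_arcs_pawalk: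
  "w \<noteq> [] \<Longrightarrow> pcas (hd w) (vwalk_arcs w) (last w) \<and> pawalk_verts (hd w) (vwalk_arcs w) = w"
  by (induction w rule: vwalk_arcs.induct) auto

text \<open>Every edge is present as an arc in both directions, so the closed vertex list can be
  read as a directed walk.\<close>

lemma (in pair_graph) odd_cycle_of_cycle_in:
  assumes "cycle_in (edges G) c" "odd (length c)"
  obtains p where "odd_cycle G p" "cycle_verts p = set c"
proof -
  let ?w = "c @ [hd c]"
  let ?p = "vwalk_arcs ?w"
  have c: "c \<noteq> []" "distinct c" using assms by (auto simp: cycle_in_def)
  then have w: "pcas (hd c) ?p (hd c)" "pawalk_verts (hd c) ?p = ?w"
    using vwalk_arcs_pawalk[of ?w] by auto
  have edge: "{a, b} \<in> edges G" if "(a, b) \<in> set ?p" for a b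
    using walk_edges_pawalk_verts[OF w(1)] w(2) assms(1) that by (force simp: cycle_in_def)
  have len: "length ?p = length c" by (metis diff_Suc_1 length_append_singleton vwalk_length_def vwalk_length_simp)
  have arcs: "set ?p \<subseteq> parcs G" using edge edges_iff by auto
  have "hd c \<in> pverts G"
  proof -
    obtain e where "e \<in> set ?p" using len c(1) by (cases ?p) auto
    then show ?thesis using w(1) arcs wellformed' by (cases ?p) auto
  qed
  moreover have "distinct (tl ?w)" using c by (cases c) auto
  moreover have "?p \<noteq> []" using len c(1) by auto
  ultimately have "odd_cycle G ?p"
    unfolding odd_cycle_def cycle_def awalk_def using w arcs len assms(2) by auto
  moreover have "cycle_verts ?p = set c"
  proof -
    have "map fst ?p = c" using pawalk_verts_conv(1)[OF w(1)] w(2) by simp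
    then have "fst ` set ?p = set c" by (metis list.set_map)
    moreover have "hd c # map snd ?p = ?w" using pawalk_verts_conv(2)[OF w(1)] w(2) by simp
    from arg_cong[OF this, of set] have "insert (hd c) (snd ` set ?p) = insert (hd c) (set c)"
      by simp
    then have "snd ` set ?p \<subseteq> set c"
      using c(1) by (metis hd_in_set insert_absorb subset_insertI)
    ultimately show ?thesis unfolding cycle_verts_def by (simp add: Un_absorb2)
  qed
  ultimately show thesis by (rule that)
qed

lemma walk_reachable:
  assumes "set (walk_edges w) \<subseteq> F" "set w \<subseteq> W" "x \<in> set w"
  shows "(hd w, x) \<in> rtrancl_on W {(u, v). {u, v} \<in> F}"
  using assms
proof (induction w rule: walk_edges.induct)
  case (1 u v ws)
  then show ?case
    by (cases "x = u") (auto intro: converse_rtrancl_on_into_rtrancl_on)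
qed auto

text \<open>The arcs of the symmetrized induced subgraph are the edges with both ends in
  \<open>W\<close>. As \<open>rtrancl_on W\<close> itself stays inside \<open>W\<close>,
  reachability can be phrased with all edges of the graph. Connectedness includes
  nonemptiness.\<close>

lemma (in pair_graph) connected_induced_iff:
  "Digraph_Component.connected (with_proj G \<restriction> W) \<longleftrightarrow>
    W \<noteq> {} \<and> (\<forall>u\<in>W. \<forall>v\<in>W. (u, v) \<in> rtrancl_on W {(u, v). {u, v} \<in> edges G})"
proof -
  let ?R = "{(u, v). {u, v} \<in> edges G}" and ?S = "parcs (mk_symmetric (with_proj G \<restriction> W))"
  have S: "?S = {(u, v). {u, v} \<in> edges G \<and> u \<in> W \<and> v \<in> W}"
    using arcs_symmetric by (force simp: mk_symmetric_def edges_iff)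
  have "rtrancl_on W ?S = rtrancl_on W ?R"
  proof (intro equalityI subrelI)
    fix u v assume "(u, v) \<in> rtrancl_on W ?S"
    then show "(u, v) \<in> rtrancl_on W ?R"
      by (induction rule: rtrancl_on_induct) (auto simp: S intro: rtrancl_on_into_rtrancl_on)
  next
    fix u v assume "(u, v) \<in> rtrancl_on W ?R"
    then show "(u, v) \<in> rtrancl_on W ?S"
      by (induction rule: rtrancl_on_induct) (auto simp: S intro: rtrancl_on_into_rtrancl_on)
  qed
  then show ?thesis
    unfolding Digraph_Component.connected_def strongly_connected_def reachable_def
    by (simp add: mk_symmetric_def)
qed

text \<open>Each cycle is connected in itself, so one edge between them joins everything; conversely
  a path from \<open>c\<close> to \<open>c'\<close> has to cross over along an edge.\<close>

lemma (in pair_graph) connected_cycles_iff: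
  assumes c: "cycle_in (edges G) c" "cycle_in (edges G) c'" and disj: "set c \<inter> set c' = {}"
  shows "Digraph_Component.connected (with_proj G \<restriction> (set c \<union> set c')) \<longleftrightarrow>
    (\<exists>u\<in>set c. \<exists>v\<in>set c'. {u, v} \<in> edges G)"
proof -
  let ?R = "{(u, v). {u, v} \<in> edges G}" and ?W = "set c \<union> set c'"
  have ne: "c \<noteq> []" "c' \<noteq> []" using c by (auto simp: cycle_in_def)
  show ?thesis
  proof
    assume conn: "Digraph_Component.connected (with_proj G \<restriction> ?W)"
    show "\<exists>u\<in>set c. \<exists>v\<in>set c'. {u, v} \<in> edges G"
    proof (rule ccontr)
      assume no: "\<not> ?thesis"
      have "(hd c, hd c') \<in> rtrancl_on ?W ?R" using conn ne by (simp add: connected_induced_iff)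
      \<comment> \<open>Membership in \<open>set c\<close> propagates along the path when no edge
        leads from \<open>c\<close> to \<open>c'\<close>.\<close>
      then have "hd c' \<in> set c"
      proof (induction rule: rtrancl_on_induct)
        case base
        then show ?case using ne by simp
      next
        case (step y z)
        then show ?case using no by auto
      qed
      moreover have "hd c' \<in> set c'" using ne by simp
      ultimately show False using disj by auto
    qed
  next
    assume "\<exists>u\<in>set c. \<exists>v\<in>set c'. {u, v} \<in> edges G"
    then obtain u v where uv: "u \<in> set c" "v \<in> set c'" "{u, v} \<in> edges G" by auto
    have sym: "(y, x) \<in> rtrancl_on ?W ?R" if "(x, y) \<in> rtrancl_on ?W ?R" for x y
    proof -
      have "sym ?R" by (auto simp: sym_def insert_commute)
      then show ?thesis using that rtrancl_on_sym by (metis symD)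
    qed
    have within: "(x, y) \<in> rtrancl_on ?W ?R"
      if d: "cycle_in (edges G) d" "set d \<subseteq> ?W" "x \<in> set d" "y \<in> set d" for d x y
    proof -
      have "d \<noteq> []" using d(3) by auto
      then have r: "(hd d, z) \<in> rtrancl_on ?W ?R" if "z \<in> set d" for z
        using walk_reachable[of "d @ [hd d]" "edges G" ?W z] d(1,2) that
        by (simp add: cycle_in_def subset_iff)
      show ?thesis by (rule rtrancl_on_trans[OF sym[OF r[OF d(3)]] r[OF d(4)]])
    qed
    have step: "(u, v) \<in> rtrancl_on ?W ?R" using uv by (auto intro: rtrancl_on_into_rtrancl_on)
    have from_u: "(u, x) \<in> rtrancl_on ?W ?R" if "x \<in> ?W" for x
    proof (cases "x \<in> set c")
      case True
      then show ?thesis using within[OF c(1) _ uv(1)] by blast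
    next
      case False
      then have "x \<in> set c'" using that by blast
      then show ?thesis using rtrancl_on_trans[OF step within[OF c(2) _ uv(2)]] by blast
    qed
    have "(x, y) \<in> rtrancl_on ?W ?R" if "x \<in> ?W" "y \<in> ?W" for x y
      by (rule rtrancl_on_trans[OF sym[OF from_u[OF that(1)]] from_u[OF that(2)]])
    then show "Digraph_Component.connected (with_proj G \<restriction> ?W)"
      using ne by (auto simp: connected_induced_iff)
  qed
qed

section \<open>The linear programs of the incidence matrix\<close>

lemma sum_nth_distinct:
  assumes "distinct fs"
  shows "(\<Sum>j = 0..<length fs. f (fs ! j)) = sum f (set fs)"
  using sum.reindex_bij_betw[OF bij_betw_nth[OF assms, of "{0..<length fs}" "set fs"], of f]
  by (simp add: lessThan_atLeast0)

lemma incidence_matrix_dim: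
  "dim_row (incidence_matrix xs fs) = length xs" "dim_col (incidence_matrix xs fs) = length fs"
  by (simp_all add: incidence_matrix_def)

lemma incidence_matrix_mult:
  assumes "distinct fs" "i < length xs"
  shows "(incidence_matrix xs fs *\<^sub>v vec (length fs) (\<lambda>j. f (fs ! j))) $ i = load (set fs) f (xs ! i)"
proof -
  have "(incidence_matrix xs fs *\<^sub>v vec (length fs) (\<lambda>j. f (fs ! j))) $ i
    = (\<Sum>j = 0..<length fs. (if xs ! i \<in> fs ! j then 1 else 0) * f (fs ! j))"
    using assms(2)
    by (simp add: incidence_matrix_def mat_of_cols_def char_vector_def scalar_prod_def)
  also have "\<dots> = (\<Sum>e\<in>set fs. (if xs ! i \<in> e then 1 else 0) * f e)"
    by (rule sum_nth_distinct[OF assms(1), of "\<lambda>e. (if xs ! i \<in> e then 1 else 0) * f e"])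
  also have "\<dots> = load (set fs) f (xs ! i)"
    unfolding load_def by (subst sum.inter_filter) (auto intro!: sum.cong)
  finally show ?thesis .
qed

lemma ones_vec_prod:
  "distinct fs \<Longrightarrow> vec (length fs) (\<lambda>j. f (fs ! j)) \<bullet> ones_vec (length fs) = sum f (set fs)"
  by (simp add: ones_vec_def scalar_prod_def sum_nth_distinct)

lemma incidence_matrix_feasible_iff:
  assumes "distinct fs"
  shows "0\<^sub>v (length fs) \<le> vec (length fs) (\<lambda>j. f (fs ! j)) \<and>
      map_vec real_of_int (vec (length xs) (\<lambda>i. a (xs ! i)))
        \<le> incidence_matrix xs fs *\<^sub>v vec (length fs) (\<lambda>j. f (fs ! j))
    \<longleftrightarrow> covers (set fs) (set xs) a f"
  using assms
  by (auto simp: less_eq_vec_def incidence_matrix_dim incidence_matrix_mult covers_def all_set_conv_all_nth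
      simp del: index_mult_mat_vec)

text \<open>In a distinct list an entry determines its position, so vectors indexed by positions are
  functions of the entries. This serves both weights on edges and demands on vertices.\<close>

lemma vec_eq_nth:
  assumes "distinct fs" "y \<in> carrier_vec (length fs)"
  obtains f where "y = vec (length fs) (\<lambda>j. f (fs ! j))"
proof
  show "y = vec (length fs) (\<lambda>j. y $ inv_into {..<length fs} ((!) fs) (fs ! j))"
    using assms inj_on_nth[OF assms(1), of "{..<length fs}"] by (intro eq_vecI) auto
qed

lemma real_values_incidence:
  assumes "distinct fs"
  shows "real_values (incidence_matrix xs fs) (vec (length xs) (\<lambda>i. a (xs ! i)))
    = cover_values (set fs) (set xs) a"
proof (intro equalityI subsetI)
  fix r assume "r \<in> real_values (incidence_matrix xs fs) (vec (length xs) (\<lambda>i. a (xs ! i)))"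
  then obtain y where y: "r = y \<bullet> ones_vec (length fs)" "y \<in> carrier_vec (length fs)"
    "0\<^sub>v (length fs) \<le> y"
    "map_vec real_of_int (vec (length xs) (\<lambda>i. a (xs ! i))) \<le> incidence_matrix xs fs *\<^sub>v y"
    by (auto simp: real_values_def incidence_matrix_dim)
  obtain f where "y = vec (length fs) (\<lambda>j. f (fs ! j))" using vec_eq_nth[OF assms y(2)] .
  then show "r \<in> cover_values (set fs) (set xs) a"
    using y incidence_matrix_feasible_iff[OF assms] ones_vec_prod[OF assms, of f]
    unfolding cover_values_def by blast
next
  fix r assume "r \<in> cover_values (set fs) (set xs) a"
  then obtain f where f: "covers (set fs) (set xs) a f" "r = sum f (set fs)"
    by (auto simp: cover_values_def)
  then show "r \<in> real_values (incidence_matrix xs fs) (vec (length xs) (\<lambda>i. a (xs ! i)))"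
    using incidence_matrix_feasible_iff[OF assms, of f xs a]
    unfolding real_values_def incidence_matrix_dim ones_vec_prod[OF assms, of f, symmetric]
    by (intro CollectI exI[of _ "vec (length fs) (\<lambda>j. f (fs ! j))"]) auto
qed

lemma integer_values_incidence:
  assumes "distinct fs"
  shows "integer_values (incidence_matrix xs fs) (vec (length xs) (\<lambda>i. a (xs ! i)))
    = int_cover_values (set fs) (set xs) a"
proof (intro equalityI subsetI)
  fix r assume "r \<in> integer_values (incidence_matrix xs fs) (vec (length xs) (\<lambda>i. a (xs ! i)))"
  then obtain y :: "nat vec" where y: "r = map_vec real y \<bullet> ones_vec (length fs)"
    "y \<in> carrier_vec (length fs)"
    "map_vec real_of_int (vec (length xs) (\<lambda>i. a (xs ! i))) \<le> incidence_matrix xs fs *\<^sub>v map_vec real y"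
    by (auto simp: integer_values_def incidence_matrix_dim)
  obtain f where f: "y = vec (length fs) (\<lambda>j. f (fs ! j))" using vec_eq_nth[OF assms y(2)] .
  define g where "g e = real (f e)" for e
  have g: "map_vec real y = vec (length fs) (\<lambda>j. g (fs ! j))"
    by (rule eq_vecI) (auto simp: f g_def)
  \<comment> \<open>Nonnegativity is implicit in the natural entries of \<open>y\<close>, whereas
    \<open>covers\<close> asks for it explicitly.\<close>
  moreover have "0\<^sub>v (length fs) \<le> vec (length fs) (\<lambda>j. g (fs ! j))"
    by (auto simp: less_eq_vec_def g_def)
  ultimately have "covers (set fs) (set xs) a g" "r = sum g (set fs)"
    using y incidence_matrix_feasible_iff[OF assms, of g xs a] ones_vec_prod[OF assms, of g] by auto
  moreover have "g e \<in> \<int>" for e by (simp add: g_def)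
  ultimately show "r \<in> int_cover_values (set fs) (set xs) a"
    unfolding int_cover_values_def by blast
next
  fix r assume "r \<in> int_cover_values (set fs) (set xs) a"
  then obtain f where f: "covers (set fs) (set xs) a f" "r = sum f (set fs)"
    "\<And>e. e \<in> set fs \<Longrightarrow> f e \<in> \<int>"
    by (auto simp: int_cover_values_def)
  \<comment> \<open>The weights on the edges are nonnegative integers, so \<open>nat\<close> and the
    floor recover them exactly.\<close>
  define y where "y = vec (length fs) (\<lambda>j. nat \<lfloor>f (fs ! j)\<rfloor>)"
  have "real (nat \<lfloor>f e\<rfloor>) = f e" if "e \<in> set fs" for e
    using f(1) f(3)[OF that] that by (auto simp: covers_def elim: Ints_cases)
  then have "map_vec real y = vec (length fs) (\<lambda>j. f (fs ! j))"
    by (intro eq_vecI) (auto simp: y_def)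
  then show "r \<in> integer_values (incidence_matrix xs fs) (vec (length xs) (\<lambda>i. a (xs ! i)))"
    using f incidence_matrix_feasible_iff[OF assms, of f xs a]
    unfolding integer_values_def incidence_matrix_dim
    by (intro CollectI exI[of _ y]) (auto simp: ones_vec_prod[OF assms] y_def)
qed

text \<open>Every integral demand vector has the form \<open>a (xs ! i)\<close> for some function
  \<open>a\<close>, so quantifying over vectors amounts to quantifying over demands on
  vertices.\<close>

lemma integer_rounding_incidence_iff:
  assumes "distinct xs" "distinct fs"
  shows "integer_rounding_property (incidence_matrix xs fs) \<longleftrightarrow>
    (\<forall>a m. is_min (cover_values (set fs) (set xs) a) m \<longrightarrow>
      is_min (int_cover_values (set fs) (set xs) a) (of_int \<lceil>m\<rceil>))"
proof -
  let ?P = "\<lambda>\<alpha>. \<forall>m. is_min (real_values (incidence_matrix xs fs) \<alpha>) m \<longrightarrow>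
      is_min (integer_values (incidence_matrix xs fs) \<alpha>) (of_int \<lceil>m\<rceil>)"
  have "(\<forall>\<alpha>\<in>carrier_vec (length xs). ?P \<alpha>) \<longleftrightarrow> (\<forall>a. ?P (vec (length xs) (\<lambda>i. a (xs ! i))))"
  proof (intro iffI allI ballI)
    fix \<alpha> :: "int vec" assume *: "\<forall>a. ?P (vec (length xs) (\<lambda>i. a (xs ! i)))" "\<alpha> \<in> carrier_vec (length xs)"
    obtain a where "\<alpha> = vec (length xs) (\<lambda>i. a (xs ! i))" using vec_eq_nth[OF assms(1) *(2)] .
    then show "is_min (real_values (incidence_matrix xs fs) \<alpha>) m \<longrightarrow>
      is_min (integer_values (incidence_matrix xs fs) \<alpha>) (of_int \<lceil>m\<rceil>)" for m using * by blast
  qed auto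
  then show ?thesis
    unfolding integer_rounding_property_def incidence_matrix_dim
    by (simp only: real_values_incidence[OF assms(2)] integer_values_incidence[OF assms(2)])
qed

section \<open>Integer rounding and pairs of disjoint odd cycles\<close>

theorem theorem3p2:
  fixes G :: "'a pair_pre_digraph" and xs :: "'a list" and fs :: "'a set list"
  assumes "pair_graph G"
    and "no_isolated_vertices G"
    and "Digraph_Component.connected (with_proj G)"
    and "distinct xs" and "set xs = pverts G"
    and "distinct fs" and "set fs = edges G"
  shows "integer_rounding_property (incidence_matrix xs fs) \<longleftrightarrow>
    (\<forall>p p'. odd_cycle G p \<and> odd_cycle G p' \<and> cycle_verts p \<inter> cycle_verts p' = {} \<longrightarrow>
       Digraph_Component.connected (with_proj G \<restriction> (cycle_verts p \<union> cycle_verts p')))"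
proof -
  interpret pair_graph G by fact
  interpret edges: edge_set "edges G" by (rule edge_set_edges)
  have prob: "cover_problem (edges G) (pverts G)"
    using pair_finite_verts edges_subset by unfold_locales
  show ?thesis
    unfolding integer_rounding_incidence_iff[OF \<open>distinct xs\<close> \<open>distinct fs\<close>]
      \<open>set xs = pverts G\<close> \<open>set fs = edges G\<close>
  proof (intro iffI allI impI)
    fix p p'
    assume rounding: "\<forall>a m. is_min (cover_values (edges G) (pverts G) a) m \<longrightarrow>
        is_min (int_cover_values (edges G) (pverts G) a) (of_int \<lceil>m\<rceil>)"
      and p: "odd_cycle G p \<and> odd_cycle G p' \<and> cycle_verts p \<inter> cycle_verts p' = {}"
    obtain c where c: "cycle_in (edges G) c" "odd (length c)" "set c = cycle_verts p"
      by (rule cycle_in_of_odd_cycle[OF conjunct1[OF p]])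
    obtain c' where c': "cycle_in (edges G) c'" "odd (length c')" "set c' = cycle_verts p'"
      by (rule cycle_in_of_odd_cycle[OF conjunct1[OF conjunct2[OF p]]])
    have disj: "set c \<inter> set c' = {}" using p c c' by simp
    have "\<exists>u\<in>set c. \<exists>v\<in>set c'. {u, v} \<in> edges G"
      using edges.cycles_adjacent_if_rounding[OF pair_finite_verts edges_subset _ c(1) c'(1) c(2) c'(2) disj]
        rounding by blast
    then show "Digraph_Component.connected (with_proj G \<restriction> (cycle_verts p \<union> cycle_verts p'))"
      using connected_cycles_iff[OF c(1) c'(1) disj] c(3) c'(3) by simp
  next
    fix a m
    assume conn: "\<forall>p p'. odd_cycle G p \<and> odd_cycle G p' \<and> cycle_verts p \<inter> cycle_verts p' = {} \<longrightarrow>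
        Digraph_Component.connected (with_proj G \<restriction> (cycle_verts p \<union> cycle_verts p'))"
      and min: "is_min (cover_values (edges G) (pverts G) a) m"
    show "is_min (int_cover_values (edges G) (pverts G) a) (of_int \<lceil>m\<rceil>)"
    proof (rule cover_problem.rounding_if_cycles_adjacent[OF prob _ min])
      fix c c'
      assume c: "cycle_in (edges G) c" "cycle_in (edges G) c'" "odd (length c)" "odd (length c')"
        and disj: "set c \<inter> set c' = {}"
      obtain p where "odd_cycle G p" "cycle_verts p = set c"
        by (rule odd_cycle_of_cycle_in[OF c(1) c(3)])
      moreover obtain p' where "odd_cycle G p'" "cycle_verts p' = set c'"
        by (rule odd_cycle_of_cycle_in[OF c(2) c(4)])
      ultimately have "Digraph_Component.connected (with_proj G \<restriction> (set c \<union> set c'))"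
        using conn disj by metis
      then show "\<exists>u\<in>set c. \<exists>v\<in>set c'. {u, v} \<in> edges G"
        using connected_cycles_iff[OF c(1,2) disj] by simp
    qed
  qed
qed

end
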